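(* Let $\alpha:[0,\infty)\to(0,\infty)$ be continuously differentiable, write $\alpha^*(t):=\sup_{0\le r\le t}\alpha(r)$, and assume: (i) there are $\gamma\in[0,1/2]$, $\beta>0$ and $C>0$ such that $(\alpha^*(t+1))^{2\gamma}/\alpha(t)\le C\,t^{-\beta}$ for all $0\le t<\infty$ (with $0^{-\beta}:=+\infty$); (ii) $\sup_{t\ge0}|\alpha'(t)/\alpha(t)|<\infty$; (iii) there are $\rho>1$, $t_0>0$ and a constant $C>0$ such that $\alpha(t)\ge C\,t^{\rho}$ for all $t\ge t_0$. Let $X$ be the solution of $dX_t=-\alpha(t)X_t\,dt+dW_t$, $X_0=0$, and let $\mathcal L_t=\mathcal L_t^0$ be its local time at level $0$. Then $$\lim_{t\to\infty}\mathcal L_t=\infty\quad\text{almost surely.}$$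
   Context: $W=(W_t)_{t\ge0}$ is a standard one-dimensional Brownian motion on a complete filtered probability space, and $X_t=\int_0^t\exp(-\int_s^t\alpha(u)\,du)\,dW_s$ (continuous version). The local time at level $x$, formally $\mathcal L_t^x=\int_0^t\delta(X_r-x)\,dr$ with $\delta$ the Dirac delta at $0$, is the limit in $L^2$ as $\varepsilon\to0+$ of $\mathcal L_{t,\varepsilon}^x:=\int_0^t p_\varepsilon(X_r-x)\,dr$, where $p_\varepsilon(y)=\frac1{\sqrt{2\pi\varepsilon}}e^{-y^2/(2\varepsilon)}$ (this limit exists for all $0<t<\infty$, $x\in\mathbb R$). The process $(\mathcal L_t)_{t\ge0}$ is taken in a version that is almost surely nondecreasing in $t$. *)

theory Defs
  imports "HOL-Probability.Probability"
begin

text \<open>Time is the type \<^typ>\<open>real\<close>, and every condition is imposed for nonnegative times only.\<close>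

locale complete_filtered_prob_space = prob_space M + complete_measure M
  for M :: "'a measure" +
  fixes F :: "real \<Rightarrow> 'a measure"
  assumes subalgebra_F: "\<And>t. 0 \<le> t \<Longrightarrow> subalgebra M (F t)"
    and F_mono: "\<And>s t. 0 \<le> s \<Longrightarrow> s \<le> t \<Longrightarrow> sets (F s) \<subseteq> sets (F t)"
    and null_sets_F: "null_sets M \<subseteq> sets (F 0)"

definition adapted :: "(real \<Rightarrow> 'a measure) \<Rightarrow> (real \<Rightarrow> 'a \<Rightarrow> real) \<Rightarrow> bool" where
  "adapted F X \<longleftrightarrow> (\<forall>t\<ge>0. X t \<in> borel_measurable (F t))"

definition continuous_paths :: "'a measure \<Rightarrow> (real \<Rightarrow> 'a \<Rightarrow> real) \<Rightarrow> bool" where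
  "continuous_paths M X \<longleftrightarrow> (AE \<omega> in M. continuous_on {0..} (\<lambda>t. X t \<omega>))"

definition brownian_motion ::
    "'a measure \<Rightarrow> (real \<Rightarrow> 'a measure) \<Rightarrow> (real \<Rightarrow> 'a \<Rightarrow> real) \<Rightarrow> bool" where
  "brownian_motion M F W \<longleftrightarrow>
     adapted F W \<and> continuous_paths M W \<and> (AE \<omega> in M. W 0 \<omega> = 0) \<and>
     (\<forall>s t. 0 \<le> s \<and> s < t \<longrightarrow>
        distributed M lborel (\<lambda>\<omega>. W t \<omega> - W s \<omega>) (normal_density 0 (sqrt (t - s))) \<and>
        prob_space.indep_set M (sets (F s))
          (sets (vimage_algebra (space M) (\<lambda>\<omega>. W t \<omega> - W s \<omega>) borel)))"

text \<open>
  The equation \<open>dX\<^sub>t = - \<alpha>(t) X\<^sub>t dt + dW\<^sub>t\<close>, \<open>X\<^sub>0 = 0\<close>, in integral form. The noise is additive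
  and \<open>W\<^sub>0 = 0\<close>, so the stochastic integral of the constant 1 over \<open>[0,t]\<close> is \<open>W\<^sub>t\<close>.
\<close>

definition sde_solution ::
    "'a measure \<Rightarrow> (real \<Rightarrow> 'a measure) \<Rightarrow> (real \<Rightarrow> 'a \<Rightarrow> real) \<Rightarrow> (real \<Rightarrow> real)
      \<Rightarrow> (real \<Rightarrow> 'a \<Rightarrow> real) \<Rightarrow> bool" where
  "sde_solution M F W \<alpha> X \<longleftrightarrow>
     adapted F X \<and> continuous_paths M X \<and> (AE \<omega> in M. X 0 \<omega> = 0) \<and>
     (AE \<omega> in M. \<forall>t\<ge>0. X t \<omega> = (LINT s:{0..t}|lborel. - \<alpha> s * X s \<omega>) + W t \<omega>)"

definition heat_kernel :: "real \<Rightarrow> real \<Rightarrow> real" where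
  "heat_kernel \<epsilon> y = 1 / sqrt (2 * pi * \<epsilon>) * exp (- y\<^sup>2 / (2 * \<epsilon>))"

definition approx_local_time ::
    "(real \<Rightarrow> 'a \<Rightarrow> real) \<Rightarrow> real \<Rightarrow> real \<Rightarrow> real \<Rightarrow> 'a \<Rightarrow> real" where
  "approx_local_time X x \<epsilon> t \<omega> = (LINT r:{0..t}|lborel. heat_kernel \<epsilon> (X r \<omega> - x))"

text \<open>
  \<open>L\<close> is a version of the local time of \<open>X\<close> at level \<open>x\<close>: each \<open>L t\<close> is the limit in \<open>L\<^sup>2(M)\<close> of
  the approximations (the squared distance is a nonnegative integral, so it cannot vanish for lack
  of integrability), and almost every path is nondecreasing.
\<close>

definition local_time ::
    "'a measure \<Rightarrow> (real \<Rightarrow> 'a \<Rightarrow> real) \<Rightarrow> real \<Rightarrow> (real \<Rightarrow> 'a \<Rightarrow> real) \<Rightarrow> bool" where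
  "local_time M X x L \<longleftrightarrow>
     (\<forall>t\<ge>0. L t \<in> borel_measurable M \<and> integrable M (\<lambda>\<omega>. (L t \<omega>)\<^sup>2) \<and>
        ((\<lambda>\<epsilon>. \<integral>\<^sup>+ \<omega>. ennreal ((approx_local_time X x \<epsilon> t \<omega> - L t \<omega>)\<^sup>2) \<partial>M) \<longlongrightarrow> 0)
          (at_right 0)) \<and>
     (AE \<omega> in M. mono_on {0..} (\<lambda>t. L t \<omega>))"

definition running_sup :: "(real \<Rightarrow> real) \<Rightarrow> real \<Rightarrow> real" where
  "running_sup \<alpha> t = (SUP r\<in>{0..t}. \<alpha> r)"

end

theory Submission imports Defs begin

text \<open>
  Write \<open>A\<close> for the primitive of the drift \<open>\<alpha>\<close> and \<open>clock\<close> for the primitive of \<open>exp (2 * A)\<close>; then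
  \<open>X\<^sub>t\<close> is centred Gaussian with variance \<open>var t = clock t / exp (2 * A t)\<close>, and the squared
  correlation of \<open>X\<^sub>s\<close> and \<open>X\<^sub>r\<close> for \<open>s < r\<close> is \<open>clock s / clock r\<close>. Since \<open>1 / var\<close> is the
  logarithmic derivative of \<open>clock\<close>, the double integral for the variance of the approximate local
  time is, after the AM-GM bound for \<open>1 / sqrt (var s * var r)\<close>, explicitly integrable and at most
  \<open>2 * t / pi\<close>, uniformly in \<open>\<epsilon>\<close>. As \<open>\<alpha>\<close> is bounded away from \<open>0\<close>, \<open>var\<close> is bounded and the mean
  grows at least linearly in \<open>t\<close>. By Chebyshev, \<open>L t\<close> exceeds a linear function of \<open>t\<close> with
  probability tending to \<open>1\<close>, and monotonicity of \<open>L\<close> turns this into almost sure divergence.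

  The Gaussian moments are obtained without stochastic integrals or characteristic functions:
  adding an independent centred Gaussian variable inside a heat kernel amounts, in expectation, to
  adding its variance to the parameter of the kernel.
\<close>

section \<open>Primitives on a half-line and improper integrals of nonnegative derivatives\<close>

lemma integral_has_real_derivative_atLeast:
  fixes f :: "real \<Rightarrow> real"
  assumes f: "continuous_on {a..} f" and t: "a \<le> t"
  shows "((\<lambda>t. integral {a..t} f) has_real_derivative f t) (at t within {a..})"
proof -
  have "((\<lambda>t. integral {a..t} f) has_real_derivative f t) (at t within {a..t + 1})"
    using t by (intro integral_has_real_derivative continuous_on_subset[OF f]) auto
  moreover have "at t within {a..t + 1} = at t within {a..}"
    by (rule at_within_nhd[where S = "{..<t + 1}"]) auto
  ultimately show ?thesis by simp
qed

text \<open>To the left of \<open>a\<close> the interval of integration is empty, so the primitive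
  continues as the constant 0. Continuity on all of the line makes \<open>A\<close> and
  \<open>clock\<close> Borel measurable and spares later steps a restriction to nonnegative
  times.\<close>

lemma integral_continuous_on_UNIV:
  fixes f :: "real \<Rightarrow> real"
  assumes f: "continuous_on {a..} f"
  shows "continuous_on UNIV (\<lambda>t. integral {a..t} f)"
proof -
  have "continuous_on {a..} (\<lambda>t. integral {a..t} f)"
    using integral_has_real_derivative_atLeast[OF f]
    by (auto simp: continuous_on_eq_continuous_within intro!: DERIV_continuous)
  then have "continuous_on UNIV (\<lambda>t. integral {a..max a t} f)"
    by (rule continuous_on_compose2) (auto intro: continuous_intros)
  moreover have "integral {a..max a t} f = integral {a..t} f" for t
    by (auto simp: max_def)
  ultimately show ?thesis by simp
qed

text \<open>The interval is open because the integrands of interest blow up at one endpoint, where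
  only the primitive stays continuous. Nonnegativity of the integrand makes integrability a
  consequence instead of an assumption.\<close>

lemma nn_integral_FTC_Ioo:
  fixes f F :: "real \<Rightarrow> real"
  assumes "a < b" and F: "continuous_on {a..b} F"
    and deriv: "\<And>x. a < x \<Longrightarrow> x < b \<Longrightarrow> (F has_real_derivative f x) (at x)"
    and cont: "\<And>x. a < x \<Longrightarrow> x < b \<Longrightarrow> isCont f x"
    and nonneg: "\<And>x. a < x \<Longrightarrow> x < b \<Longrightarrow> 0 \<le> f x"
  shows "(\<integral>\<^sup>+x\<in>{a<..<b}. ennreal (f x) \<partial>lborel) = ennreal (F b - F a)"
proof -
  have "((F \<circ> real_of_ereal) \<longlongrightarrow> F a) (at_right (ereal a))"
    using F \<open>a < b\<close> unfolding ereal_tendsto_simps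
    by (metis atLeastAtMost_iff continuous_on_Icc_at_rightD)
  moreover have "((F \<circ> real_of_ereal) \<longlongrightarrow> F b) (at_left (ereal b))"
    using F \<open>a < b\<close> unfolding ereal_tendsto_simps
    by (metis atLeastAtMost_iff continuous_on_Icc_at_leftD)
  ultimately have *: "set_integrable lborel (einterval a b) f" "(LBINT x=a..b. f x) = F b - F a"
    using interval_integral_FTC_nonneg[of a b F f "F a" "F b"] assms by auto
  have "(\<integral>\<^sup>+x\<in>{a<..<b}. ennreal (f x) \<partial>lborel) = (\<integral>\<^sup>+x. ennreal (indicator {a<..<b} x * f x) \<partial>lborel)"
    by (intro nn_integral_cong) (auto split: split_indicator)
  also have "\<dots> = ennreal (\<integral>x. indicator {a<..<b} x * f x \<partial>lborel)"
    using *(1) nonneg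
    by (intro nn_integral_eq_integral) (auto simp: set_integrable_def split: split_indicator)
  also have "(\<integral>x. indicator {a<..<b} x * f x \<partial>lborel) = F b - F a"
    using *(2) \<open>a < b\<close> by (simp add: interval_lebesgue_integral_def set_lebesgue_integral_def)
  finally show ?thesis .
qed

lemma at_within_interior_atLeast: "a < t \<Longrightarrow> at t within {a..} = at (t::real)"
  by (rule at_within_interior) (simp add: interior_real_atLeast)

section \<open>The clock, the variance and the correlation kernel of the process\<close>

locale coercive_drift =
  fixes \<alpha> :: "real \<Rightarrow> real" and c :: real
  assumes cont_drift: "continuous_on {0..} \<alpha>"
    and c_pos: "0 < c"
    and c_le_drift: "\<And>t. 0 \<le> t \<Longrightarrow> c \<le> \<alpha> t"
begin

definition A :: "real \<Rightarrow> real" where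
  "A t = integral {0..t} \<alpha>"

text \<open>This is the quadratic variation of the martingale \<open>exp (A t) * X t\<close>,
  obtained from the equation by the integrating factor \<open>exp (A t)\<close>.\<close>

definition clock :: "real \<Rightarrow> real" where
  "clock t = integral {0..t} (\<lambda>u. exp (2 * A u))"

definition var :: "real \<Rightarrow> real" where
  "var t = clock t / exp (2 * A t)"

lemma A_deriv: "0 \<le> t \<Longrightarrow> (A has_real_derivative \<alpha> t) (at t within {0..})"
  unfolding A_def[abs_def] by (rule integral_has_real_derivative_atLeast[OF cont_drift])

lemma cont_A: "continuous_on UNIV A"
  unfolding A_def[abs_def] by (rule integral_continuous_on_UNIV[OF cont_drift])

lemma cont_exp_A: "continuous_on S (\<lambda>u. exp (k * A u))"
  by (intro continuous_intros continuous_on_subset[OF cont_A]) auto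

lemma clock_deriv: "0 \<le> t \<Longrightarrow> (clock has_real_derivative exp (2 * A t)) (at t within {0..})"
  unfolding clock_def[abs_def] by (rule integral_has_real_derivative_atLeast[OF cont_exp_A])

lemma cont_clock: "continuous_on UNIV clock"
  unfolding clock_def[abs_def] by (rule integral_continuous_on_UNIV[OF cont_exp_A])

lemma clock_deriv_at: "0 < t \<Longrightarrow> (clock has_real_derivative exp (2 * A t)) (at t)"
  using clock_deriv[of t] by (simp add: at_within_interior_atLeast)

lemma isCont_exp_A: "isCont (\<lambda>u. exp (k * A u)) t"
  using cont_exp_A[of UNIV k] by (simp add: continuous_on_eq_continuous_at)

lemma isCont_clock: "isCont clock t"
  using cont_clock by (simp add: continuous_on_eq_continuous_at)

lemma A_measurable [measurable]: "A \<in> borel_measurable borel"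
  by (rule borel_measurable_continuous_onI[OF cont_A])

lemma clock_measurable [measurable]: "clock \<in> borel_measurable borel"
  by (rule borel_measurable_continuous_onI[OF cont_clock])

lemma clock_0 [simp]: "clock 0 = 0"
  by (simp add: clock_def)

lemma A_0 [simp]: "A 0 = 0"
  by (simp add: A_def)

lemma clock_less:
  assumes s: "0 \<le> s" "s < t"
  shows "clock s < clock t"
proof (rule DERIV_pos_imp_increasing_open[where f = clock, OF s(2)])
  fix x assume "s < x" "x < t"
  with s show "\<exists>y. (clock has_real_derivative y) (at x) \<and> 0 < y"
    using clock_deriv_at[of x] by (intro exI[of _ "exp (2 * A x)"]) auto
qed (auto intro: continuous_on_subset[OF cont_clock])

lemma clock_pos: "0 < t \<Longrightarrow> 0 < clock t"
  using clock_less[of 0 t] by simp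

lemma clock_nonneg: "0 \<le> t \<Longrightarrow> 0 \<le> clock t"
  using clock_pos[of t] by (cases "t = 0") auto

lemma var_pos: "0 < t \<Longrightarrow> 0 < var t"
  by (simp add: var_def clock_pos)

lemma var_nonneg: "0 \<le> t \<Longrightarrow> 0 \<le> var t"
  by (simp add: var_def clock_nonneg)

lemma var_measurable [measurable]: "var \<in> borel_measurable borel"
  unfolding var_def[abs_def] by measurable

text \<open>Since \<open>c\<close> is a lower bound of \<alpha>, the function
  \<open>exp (2 * A u) / (2 * c)\<close> grows at least as fast as the clock, and it starts from a
  positive value while the clock starts from 0.\<close>

lemma var_le: "0 \<le> t \<Longrightarrow> var t \<le> 1 / (2 * c)"
proof -
  assume t: "0 \<le> t"
  define G where "G u = exp (2 * A u) / (2 * c) - clock u" for u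
  have "G 0 \<le> G t"
  proof (cases "t = 0")
    case False
    show ?thesis
    proof (rule DERIV_nonneg_imp_increasing_open[where f = G])
      fix x :: real assume x: "0 < x" "x < t"
      have "(G has_real_derivative (exp (2 * A x) * (2 * \<alpha> x) / (2 * c) - exp (2 * A x))) (at x)"
        unfolding G_def using A_deriv[of x] clock_deriv_at[of x] x c_pos
        by (auto intro!: derivative_eq_intros simp: at_within_interior_atLeast)
      moreover have "exp (2 * A x) * (2 * \<alpha> x) / (2 * c) - exp (2 * A x) \<ge> 0"
        using c_le_drift[of x] x c_pos by (simp add: field_simps)
      ultimately show "\<exists>y. (G has_real_derivative y) (at x) \<and> 0 \<le> y" by blast
    next
      show "continuous_on {0..t} G"
        unfolding G_def using c_pos
        by (intro continuous_intros continuous_on_subset[OF cont_exp_A] continuous_on_subset[OF cont_clock]) auto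
    qed (use t in auto)
  qed simp
  moreover have "0 < G 0" using c_pos by (simp add: G_def)
  ultimately have "clock t \<le> exp (2 * A t) / (2 * c)"
    unfolding G_def by linarith
  then show ?thesis
    by (simp add: var_def field_simps)
qed

text \<open>
  With \<open>\<varrho>\<close> the correlation of \<open>X x\<close> and \<open>X y\<close>, this is \<open>\<varrho>\<^sup>2 / sqrt (1 - \<varrho>\<^sup>2)\<close> times
  \<open>1 / var y\<close>, which is the logarithmic derivative of the clock at \<open>y\<close>.
\<close>

definition corr :: "real \<Rightarrow> real \<Rightarrow> real" where
  "corr x y = (let q = clock (min x y) / clock (max x y)
     in exp (2 * A y) / clock y * (q / sqrt (1 - q)))"

text \<open>For \<open>y < x\<close> the factor \<open>clock y\<close> cancels, and what remains is
  the derivative in \<open>y\<close> of \<open>- 2 * sqrt (1 - q)\<close> with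
  \<open>q = clock y / clock x\<close>. As \<open>q\<close> runs from 0 to 1 this primitive rises
  from -2 to 0.\<close>

lemma corr_below:
  assumes x: "0 < x"
  shows "(\<integral>\<^sup>+y\<in>{0<..<x}. ennreal (corr x y) \<partial>lborel) = 2"
proof -
  have lt: "clock y < clock x" if "0 < y" "y < x" for y
    using clock_less that by auto
  have eq: "corr x y = exp (2 * A y) / clock x / sqrt (1 - clock y / clock x)" if "0 < y" "y < x" for y
    using that clock_pos[of y] by (simp add: corr_def Let_def min_def max_def)
  have "(\<integral>\<^sup>+y\<in>{0<..<x}. ennreal (corr x y) \<partial>lborel) =
     (\<integral>\<^sup>+y\<in>{0<..<x}. ennreal (exp (2 * A y) / clock x / sqrt (1 - clock y / clock x)) \<partial>lborel)"
    by (intro nn_integral_cong) (auto simp: eq split: split_indicator)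
  also have "\<dots> = ennreal (- 2 * sqrt (1 - clock x / clock x) - - 2 * sqrt (1 - clock 0 / clock x))"
  proof (rule nn_integral_FTC_Ioo[where F = "\<lambda>y. - 2 * sqrt (1 - clock y / clock x)"])
    show "continuous_on {0..x} (\<lambda>y. - 2 * sqrt (1 - clock y / clock x))"
      using clock_pos[OF x] by (intro continuous_intros continuous_on_subset[OF cont_clock]) auto
  next
    fix y assume y: "0 < y" "y < x"
    then have pos: "1 - clock y / clock x > 0" using lt[of y] clock_pos[of x] by simp
    show "((\<lambda>y. - 2 * sqrt (1 - clock y / clock x)) has_real_derivative
        exp (2 * A y) / clock x / sqrt (1 - clock y / clock x)) (at y)"
      using pos clock_pos[OF x] y
      by (auto intro!: derivative_eq_intros clock_deriv_at simp: field_simps)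
    show "isCont (\<lambda>y. exp (2 * A y) / clock x / sqrt (1 - clock y / clock x)) y"
      using pos clock_pos[OF x] y by (intro continuous_intros isCont_exp_A isCont_clock) auto
    show "0 \<le> exp (2 * A y) / clock x / sqrt (1 - clock y / clock x)"
      using pos clock_pos[OF x] y by auto
  qed (use x in auto)
  also have "\<dots> = 2"
    using clock_pos[OF x] by simp
  finally show ?thesis .
qed

text \<open>Here \<open>q = clock x / clock y\<close> decreases in \<open>y\<close>, and the
  integrand is the derivative of \<open>2 * sqrt (1 - q)\<close>, which starts at 0 and never
  exceeds 2.\<close>

lemma corr_above:
  assumes x: "0 < x" "x < t"
  shows "(\<integral>\<^sup>+y\<in>{x<..<t}. ennreal (corr x y) \<partial>lborel) \<le> 2"
proof -
  have lt: "0 < clock x" "0 < clock y" "clock x < clock y" if "x < y" for y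
    using clock_less[of x y] that clock_pos[of x] clock_pos[of y] x by auto
  define f where "f y = exp (2 * A y) * clock x / (clock y)\<^sup>2 / sqrt (1 - clock x / clock y)" for y
  have eq: "corr x y = f y" if "x < y" for y
    using that clock_pos[of y] by (simp add: corr_def Let_def min_def max_def f_def power2_eq_square)
  have "(\<integral>\<^sup>+y\<in>{x<..<t}. ennreal (corr x y) \<partial>lborel) = (\<integral>\<^sup>+y\<in>{x<..<t}. ennreal (f y) \<partial>lborel)"
    by (intro nn_integral_cong) (auto simp: eq split: split_indicator)
  also have "\<dots> = ennreal (2 * sqrt (1 - clock x / clock t) - 2 * sqrt (1 - clock x / clock x))"
  proof (rule nn_integral_FTC_Ioo[where F = "\<lambda>y. 2 * sqrt (1 - clock x / clock y)"])
    have "clock y \<noteq> 0" if "x \<le> y" for y using clock_pos[of y] that x by auto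
    then show "continuous_on {x..t} (\<lambda>y. 2 * sqrt (1 - clock x / clock y))"
      using x by (intro continuous_intros continuous_on_subset[OF cont_clock]) auto
  next
    fix y assume y: "x < y" "y < t"
    note ly = lt[OF y(1)]
    then have pos: "1 - clock x / clock y > 0" by simp
    show "((\<lambda>y. 2 * sqrt (1 - clock x / clock y)) has_real_derivative f y) (at y)"
      using pos ly y x unfolding f_def
      by (auto intro!: derivative_eq_intros clock_deriv_at simp: field_simps power2_eq_square)
    show "isCont f y"
      using pos ly y x unfolding f_def by (intro continuous_intros isCont_exp_A isCont_clock) auto
    show "0 \<le> f y"
      using pos ly y x unfolding f_def by auto
  qed (use x in auto)
  also have "\<dots> \<le> ennreal 2"
    using lt[OF x(2)] by (intro ennreal_leI) auto
  finally show ?thesis by simp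
qed

lemma corr_measurable [measurable]: "(\<lambda>(x, y). corr x y) \<in> borel_measurable (borel \<Otimes>\<^sub>M borel)"
  unfolding corr_def Let_def by measurable

text \<open>The bound is free of both \<open>x\<close> and \<open>t\<close>. A further integration
  over \<open>x\<close> in an interval of length \<open>t\<close> therefore gives only linear
  growth, while the squared mean grows quadratically.\<close>

lemma nn_integral_corr_le:
  assumes x: "0 < x" "x < t"
  shows "(\<integral>\<^sup>+y\<in>{0..t}. ennreal (corr x y) \<partial>lborel) \<le> 4"
proof -
  have "(\<integral>\<^sup>+y\<in>{0..t}. ennreal (corr x y) \<partial>lborel) =
      (\<integral>\<^sup>+y. ennreal (corr x y) * indicator {0<..<x} y + ennreal (corr x y) * indicator {x<..<t} y \<partial>lborel)"
  proof (rule nn_integral_cong_AE)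
    have "AE y in lborel. y \<noteq> 0" "AE y in lborel. y \<noteq> x" "AE y in lborel. y \<noteq> t"
      by (rule AE_lborel_singleton)+
    then show "AE y in lborel. ennreal (corr x y) * indicator {0..t} y =
        ennreal (corr x y) * indicator {0<..<x} y + ennreal (corr x y) * indicator {x<..<t} y"
      by eventually_elim (use x in \<open>auto split: split_indicator\<close>)
  qed
  also have "\<dots> = (\<integral>\<^sup>+y\<in>{0<..<x}. ennreal (corr x y) \<partial>lborel) + (\<integral>\<^sup>+y\<in>{x<..<t}. ennreal (corr x y) \<partial>lborel)"
    by (intro nn_integral_add) measurable
  also have "\<dots> \<le> 2 + 2"
    using corr_below[of x] corr_above[of x t] x by (intro add_mono) auto
  finally show ?thesis by simp
qed

end

section \<open>Heat kernels and independent Gaussian variables\<close>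

lemma heat_kernel_eq_normal_density: "0 \<le> \<epsilon> \<Longrightarrow> heat_kernel \<epsilon> y = normal_density 0 (sqrt \<epsilon>) y"
  by (simp add: heat_kernel_def normal_density_def)

lemma heat_kernel_nonneg: "0 \<le> \<epsilon> \<Longrightarrow> 0 \<le> heat_kernel \<epsilon> y"
  by (simp add: heat_kernel_def)

lemma heat_kernel_minus: "heat_kernel \<epsilon> (- y) = heat_kernel \<epsilon> y"
  by (simp add: heat_kernel_def)

lemma heat_kernel_0: "heat_kernel \<epsilon> 0 = 1 / sqrt (2 * pi * \<epsilon>)"
  by (simp add: heat_kernel_def)

lemma heat_kernel_le: "0 < \<epsilon> \<Longrightarrow> heat_kernel \<epsilon> y \<le> 1 / sqrt (2 * pi * \<epsilon>)"
  unfolding heat_kernel_def by (rule mult_left_le) auto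

lemma heat_kernel_measurable [measurable]: "heat_kernel \<epsilon> \<in> borel_measurable borel"
  unfolding heat_kernel_def[abs_def] by measurable

lemma isCont_heat_kernel: "isCont (heat_kernel \<epsilon>) y"
  unfolding heat_kernel_def[abs_def] by (cases "\<epsilon> = 0") (auto intro!: continuous_intros)

text \<open>This is the semigroup property of the heat kernel. Evenness of the kernel turns the sum
  \<open>b + y\<close> into the difference that a convolution requires.\<close>

lemma nn_integral_heat_kernel_normal:
  assumes "0 < \<epsilon>" "0 < \<sigma>"
  shows "(\<integral>\<^sup>+y. ennreal (normal_density 0 \<sigma> y) * ennreal (heat_kernel \<epsilon> (b + y)) \<partial>lborel) =
    ennreal (heat_kernel (\<epsilon> + \<sigma>\<^sup>2) b)"
proof -
  have "(\<integral>\<^sup>+y. ennreal (normal_density 0 \<sigma> y) * ennreal (heat_kernel \<epsilon> (b + y)) \<partial>lborel) =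
      (\<integral>\<^sup>+y. ennreal (normal_density 0 (sqrt \<epsilon>) (- b - y) * normal_density 0 \<sigma> y) \<partial>lborel)"
  proof (rule nn_integral_cong)
    fix y
    have "heat_kernel \<epsilon> (b + y) = normal_density 0 (sqrt \<epsilon>) (- b - y)"
      using assms heat_kernel_minus[of \<epsilon> "b + y"] by (simp add: heat_kernel_eq_normal_density)
    then show "ennreal (normal_density 0 \<sigma> y) * ennreal (heat_kernel \<epsilon> (b + y)) =
        ennreal (normal_density 0 (sqrt \<epsilon>) (- b - y) * normal_density 0 \<sigma> y)"
      by (simp add: ennreal_mult[symmetric] mult.commute)
  qed
  also have "\<dots> = ennreal (normal_density 0 (sqrt ((sqrt \<epsilon>)\<^sup>2 + \<sigma>\<^sup>2)) (- b))"
    using conv_normal_density_zero_mean[of "sqrt \<epsilon>" \<sigma>] assms by (simp add: fun_eq_iff)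
  also have "\<dots> = ennreal (heat_kernel (\<epsilon> + \<sigma>\<^sup>2) b)"
    using assms heat_kernel_minus[of "\<epsilon> + \<sigma>\<^sup>2" b] by (simp add: heat_kernel_eq_normal_density)
  finally show ?thesis .
qed

text \<open>By independence the \<open>G\<close>-measurable pair \<open>(f, b)\<close> can be frozen
  while \<open>D\<close> is integrated out by the convolution identity. The weight \<open>f\<close>
  will later hold the heat kernel evaluated at an earlier time.\<close>

lemma (in prob_space) nn_integral_heat_kernel_indep_normal:
  fixes f :: "'a \<Rightarrow> ennreal" and b D :: "'a \<Rightarrow> real"
  assumes G: "subalgebra M G"
    and ind: "indep_set (sets G) (sets (vimage_algebra (space M) D borel))"
    and D: "distributed M lborel D (normal_density 0 \<sigma>)" "0 < \<sigma>"
    and "\<kappa> \<noteq> 0" "0 < \<epsilon>"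
    and f: "f \<in> borel_measurable G" and b: "b \<in> borel_measurable G"
  shows "(\<integral>\<^sup>+\<omega>. f \<omega> * ennreal (heat_kernel \<epsilon> (b \<omega> + \<kappa> * D \<omega>)) \<partial>M) =
    (\<integral>\<^sup>+\<omega>. f \<omega> * ennreal (heat_kernel (\<epsilon> + \<kappa>\<^sup>2 * \<sigma>\<^sup>2) (b \<omega>)) \<partial>M)"
proof -
  \<comment> \<open>Absorbing the factor \<kappa> leaves a normal variable with standard deviation
    \<open>\<bar>\<kappa>\<bar> * \<sigma>\<close>; for \<kappa> equal to 0 it would be degenerate
    and have no density.\<close>
  define D' where "D' = (\<lambda>\<omega>. \<kappa> * D \<omega>)"
  have D': "distributed M lborel D' (normal_density 0 (\<bar>\<kappa>\<bar> * \<sigma>))"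
    using normal_density_affine[OF D \<open>\<kappa> \<noteq> 0\<close>, of 0] by (simp add: D'_def)
  let ?B = "borel \<Otimes>\<^sub>M borel :: (ennreal \<times> real) measure"
  let ?U = "\<lambda>\<omega>. (f \<omega>, b \<omega>)"
  have U_G: "?U \<in> G \<rightarrow>\<^sub>M ?B" using f b by simp
  then have U [measurable]: "?U \<in> M \<rightarrow>\<^sub>M ?B" by (rule measurable_from_subalg[OF G])
  have fb [measurable]: "f \<in> borel_measurable M" "b \<in> borel_measurable M"
    using f b G by (auto intro: measurable_from_subalg)
  have D_meas [measurable]: "D \<in> M \<rightarrow>\<^sub>M lborel" using distributed_measurable[OF D(1)] .
  have D'_meas [measurable]: "D' \<in> M \<rightarrow>\<^sub>M lborel" using distributed_measurable[OF D'] .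
  interpret PD: prob_space "distr M lborel D'" by (rule prob_space_distr) fact
  interpret PU: prob_space "distr M ?B ?U" by (rule prob_space_distr) fact
  have meas: "(\<lambda>\<omega>. (?U \<omega>, D' \<omega>)) \<in> M \<rightarrow>\<^sub>M ?B \<Otimes>\<^sub>M lborel" by measurable
  \<comment> \<open>Independence makes the joint law a product, which is checked on rectangles. A
    preimage under \<open>D'\<close> is the preimage under \<open>D\<close> of the rescaled set, so
    it lies in the sigma-algebra generated by \<open>D\<close>.\<close>
  have pair: "distr M ?B ?U \<Otimes>\<^sub>M distr M lborel D' = distr M (?B \<Otimes>\<^sub>M lborel) (\<lambda>\<omega>. (?U \<omega>, D' \<omega>))"
  proof (rule pair_measure_eqI)
    fix S T assume S: "S \<in> sets (distr M ?B ?U)" and T: "T \<in> sets (distr M lborel D')"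
    have "?U -` S \<inter> space M \<in> sets G"
      using measurable_sets[OF U_G] S G by (simp add: subalgebra_def)
    moreover have "(\<lambda>x. \<kappa> * x) -` T \<in> sets borel"
      using measurable_sets[of "\<lambda>x. \<kappa> * x" borel borel T] T by simp
    then have "D -` ((\<lambda>x. \<kappa> * x) -` T) \<inter> space M \<in> sets (vimage_algebra (space M) D borel)"
      by (rule in_vimage_algebra)
    then have "D' -` T \<inter> space M \<in> sets (vimage_algebra (space M) D borel)"
      by (simp add: D'_def vimage_comp comp_def)
    ultimately have "prob ((?U -` S \<inter> space M) \<inter> (D' -` T \<inter> space M)) =
        prob (?U -` S \<inter> space M) * prob (D' -` T \<inter> space M)"
      using ind unfolding indep_sets2_eq by blast
    moreover have "(\<lambda>\<omega>. (?U \<omega>, D' \<omega>)) -` (S \<times> T) \<inter> space M = (?U -` S \<inter> space M) \<inter> (D' -` T \<inter> space M)"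
      by auto
    ultimately show "emeasure (distr M ?B ?U) S * emeasure (distr M lborel D') T =
        emeasure (distr M (?B \<Otimes>\<^sub>M lborel) (\<lambda>\<omega>. (?U \<omega>, D' \<omega>))) (S \<times> T)"
      using S T
      by (simp add: emeasure_distr[OF meas] emeasure_distr[OF U] emeasure_distr[OF D'_meas]
          emeasure_eq_measure ennreal_mult)
  qed (simp_all add: PU.sigma_finite_measure_axioms PD.sigma_finite_measure_axioms cong: sets_pair_measure_cong)
  have "(\<integral>\<^sup>+\<omega>. f \<omega> * ennreal (heat_kernel \<epsilon> (b \<omega> + \<kappa> * D \<omega>)) \<partial>M) =
      (\<integral>\<^sup>+z. fst (fst z) * ennreal (heat_kernel \<epsilon> (snd (fst z) + snd z)) \<partial>distr M (?B \<Otimes>\<^sub>M lborel) (\<lambda>\<omega>. (?U \<omega>, D' \<omega>)))"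
    by (subst nn_integral_distr[OF meas]) (simp_all add: D'_def)
  also have "\<dots> = (\<integral>\<^sup>+p. \<integral>\<^sup>+y. fst p * ennreal (heat_kernel \<epsilon> (snd p + y)) \<partial>distr M lborel D' \<partial>distr M ?B ?U)"
    unfolding pair[symmetric] by (subst PD.nn_integral_fst[symmetric]) auto
  also have "\<dots> = (\<integral>\<^sup>+p. fst p * ennreal (heat_kernel (\<epsilon> + \<kappa>\<^sup>2 * \<sigma>\<^sup>2) (snd p)) \<partial>distr M ?B ?U)"
  proof (rule nn_integral_cong)
    fix p :: "ennreal \<times> real"
    have "(\<integral>\<^sup>+y. fst p * ennreal (heat_kernel \<epsilon> (snd p + y)) \<partial>distr M lborel D') =
        fst p * (\<integral>\<^sup>+y. ennreal (heat_kernel \<epsilon> (snd p + y)) \<partial>distr M lborel D')"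
      by (intro nn_integral_cmult) measurable
    also have "(\<integral>\<^sup>+y. ennreal (heat_kernel \<epsilon> (snd p + y)) \<partial>distr M lborel D') =
        ennreal (heat_kernel (\<epsilon> + (\<bar>\<kappa>\<bar> * \<sigma>)\<^sup>2) (snd p))"
      using nn_integral_heat_kernel_normal[of \<epsilon> "\<bar>\<kappa>\<bar> * \<sigma>" "snd p"] assms
      unfolding distributed_distr_eq_density[OF D'] by (subst nn_integral_density) auto
    finally show "(\<integral>\<^sup>+y. fst p * ennreal (heat_kernel \<epsilon> (snd p + y)) \<partial>distr M lborel D') =
        fst p * ennreal (heat_kernel (\<epsilon> + \<kappa>\<^sup>2 * \<sigma>\<^sup>2) (snd p))"
      by (simp add: power_mult_distrib)
  qed
  also have "\<dots> = (\<integral>\<^sup>+\<omega>. f \<omega> * ennreal (heat_kernel (\<epsilon> + \<kappa>\<^sup>2 * \<sigma>\<^sup>2) (b \<omega>)) \<partial>M)"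
    by (subst nn_integral_distr) auto
  finally show ?thesis .
qed

section \<open>Limits of sums over uniform partitions\<close>

text \<open>The increments of \<Phi> telescope, and local errors that are uniformly small relative
  to the step length add up to a small multiple of \<open>r - s\<close>. Using \<open>Suc n\<close>
  subintervals keeps the mesh well defined for every \<open>n\<close>.\<close>

lemma telescoping_sum_limit:
  fixes \<Phi> :: "real \<Rightarrow> real" and \<phi> :: "real \<Rightarrow> real \<Rightarrow> real"
  assumes "s < r"
    and approx: "\<And>\<eta>. 0 < \<eta> \<Longrightarrow> \<exists>\<delta>>0. \<forall>u u'. s \<le> u \<longrightarrow> u < u' \<longrightarrow> u' \<le> r \<longrightarrow> u' - u < \<delta> \<longrightarrow>
      \<bar>\<Phi> u' - \<Phi> u - \<phi> u u'\<bar> \<le> \<eta> * (u' - u)"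
  defines "p \<equiv> \<lambda>n i. s + real i * (r - s) / real (Suc n)"
  shows "(\<lambda>n. \<Sum>i<Suc n. \<phi> (p n i) (p n (Suc i))) \<longlonglongrightarrow> \<Phi> r - \<Phi> s"
proof (rule LIMSEQ_I)
  fix e :: real assume "0 < e"
  \<comment> \<open>With this choice the accumulated error is at most \<open>e / 2\<close>, which
    leaves room for the strict inequality.\<close>
  define \<eta> where "\<eta> = e / (2 * (r - s))"
  have "0 < \<eta>" using \<open>0 < e\<close> \<open>s < r\<close> by (simp add: \<eta>_def)
  from approx[OF this] obtain \<delta> where \<delta>: "0 < \<delta>"
    "\<And>u u'. s \<le> u \<Longrightarrow> u < u' \<Longrightarrow> u' \<le> r \<Longrightarrow> u' - u < \<delta> \<Longrightarrow> \<bar>\<Phi> u' - \<Phi> u - \<phi> u u'\<bar> \<le> \<eta> * (u' - u)"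
    by blast
  obtain N :: nat where N: "(r - s) / \<delta> < real N" using reals_Archimedean2 by blast
  show "\<exists>no. \<forall>n\<ge>no. norm ((\<Sum>i<Suc n. \<phi> (p n i) (p n (Suc i))) - (\<Phi> r - \<Phi> s)) < e"
  proof (intro exI allI impI)
    fix n assume "N \<le> n"
    have step: "p n (Suc i) - p n i = (r - s) / real (Suc n)" for i
      by (simp add: p_def add_divide_distrib[symmetric] diff_divide_distrib[symmetric] algebra_simps)
    have "(r - s) / real (Suc n) < \<delta>"
    proof -
      have "(r - s) / \<delta> < real (Suc n)" using N \<open>N \<le> n\<close> by linarith
      then show ?thesis using \<open>0 < \<delta>\<close> by (simp add: field_simps)
    qed
    have p_end: "p n 0 = s" "p n (Suc n) = r" by (simp_all add: p_def)
    have p_mono: "p n i \<le> p n j" if "i \<le> j" for i j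
      using that \<open>s < r\<close> by (auto simp: p_def intro!: divide_right_mono mult_right_mono)
    have "\<Phi> r - \<Phi> s = (\<Sum>i<Suc n. \<Phi> (p n (Suc i)) - \<Phi> (p n i))"
      by (subst sum_lessThan_telescope) (simp add: p_end)
    then have "\<bar>(\<Sum>i<Suc n. \<phi> (p n i) (p n (Suc i))) - (\<Phi> r - \<Phi> s)\<bar> =
        \<bar>\<Sum>i<Suc n. \<Phi> (p n (Suc i)) - \<Phi> (p n i) - \<phi> (p n i) (p n (Suc i))\<bar>"
      by (simp only: sum_subtractf abs_minus_commute)
    also have "\<dots> \<le> (\<Sum>i<Suc n. \<bar>\<Phi> (p n (Suc i)) - \<Phi> (p n i) - \<phi> (p n i) (p n (Suc i))\<bar>)"
      by (rule sum_abs)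
    also have "\<dots> \<le> (\<Sum>i<Suc n. \<eta> * (p n (Suc i) - p n i))"
    proof (rule sum_mono)
      fix i assume "i \<in> {..<Suc n}"
      then have "s \<le> p n i" "p n (Suc i) \<le> r"
        using p_mono[of 0 i] p_mono[of "Suc i" "Suc n"] p_end by auto
      moreover have "p n i < p n (Suc i)" "p n (Suc i) - p n i < \<delta>"
        using step[of i] \<open>s < r\<close> \<open>(r - s) / real (Suc n) < \<delta>\<close> by (smt (verit) divide_pos_pos of_nat_0_less_iff zero_less_Suc)+
      ultimately show "\<bar>\<Phi> (p n (Suc i)) - \<Phi> (p n i) - \<phi> (p n i) (p n (Suc i))\<bar> \<le> \<eta> * (p n (Suc i) - p n i)"
        by (intro \<delta>(2))
    qed
    also have "\<dots> = \<eta> * (r - s)"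
      by (simp only: sum_distrib_left[symmetric] sum_lessThan_telescope p_end)
    also have "\<dots> = e / 2" using \<open>s < r\<close> by (simp add: \<eta>_def field_simps)
    also have "\<dots> < e" using \<open>0 < e\<close> by simp
    finally show "norm ((\<Sum>i<Suc n. \<phi> (p n i) (p n (Suc i))) - (\<Phi> r - \<Phi> s)) < e" by simp
  qed
qed

section \<open>Heat kernels along Brownian increments\<close>

locale brownian = complete_filtered_prob_space M F for M :: "'a measure" and F +
  fixes W :: "real \<Rightarrow> 'a \<Rightarrow> real"
  assumes bm: "brownian_motion M F W"
begin

lemma measurable_F_mono:
  assumes "f \<in> F s \<rightarrow>\<^sub>M N" "0 \<le> s" "s \<le> t"
  shows "f \<in> F t \<rightarrow>\<^sub>M N"
proof (rule measurable_from_subalg[OF _ assms(1)])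
  show "subalgebra (F t) (F s)"
    using subalgebra_F[of s] subalgebra_F[of t] F_mono[of s t] assms by (auto simp: subalgebra_def)
qed

lemma W_measurable_F: "0 \<le> s \<Longrightarrow> s \<le> t \<Longrightarrow> W s \<in> borel_measurable (F t)"
  using bm measurable_F_mono[of "W s" s borel t] by (auto simp: brownian_motion_def adapted_def)

text \<open>The last increment is integrated out first, since everything before it is measurable at
  time \<open>u n\<close>. Each removal enlarges the parameter of the kernel, so the induction has
  to be general in \<epsilon>.\<close>

lemma nn_integral_heat_kernel_increments:
  fixes f :: "'a \<Rightarrow> ennreal"
  assumes u: "0 \<le> u 0" "\<And>i. u i < u (Suc i)" and \<kappa>: "\<And>i. \<kappa> i \<noteq> 0"
    and f: "f \<in> borel_measurable (F (u 0))" and b: "b \<in> borel_measurable (F (u 0))"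
  shows "0 < \<epsilon> \<Longrightarrow> (\<integral>\<^sup>+\<omega>. f \<omega> * ennreal (heat_kernel \<epsilon> (b \<omega> + (\<Sum>i<n. \<kappa> i * (W (u (Suc i)) \<omega> - W (u i) \<omega>)))) \<partial>M) =
    (\<integral>\<^sup>+\<omega>. f \<omega> * ennreal (heat_kernel (\<epsilon> + (\<Sum>i<n. (\<kappa> i)\<^sup>2 * (u (Suc i) - u i))) (b \<omega>)) \<partial>M)"
proof (induction n arbitrary: \<epsilon>)
  case (Suc n)
  have mono: "u i \<le> u j" if "i \<le> j" for i j
    using lift_Suc_mono_le[of u, OF less_imp_le[OF u(2)] that] .
  have nonneg: "0 \<le> u i" for i using mono[of 0 i] u(1) by simp
  let ?b = "\<lambda>\<omega>. b \<omega> + (\<Sum>i<n. \<kappa> i * (W (u (Suc i)) \<omega> - W (u i) \<omega>))"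
  let ?D = "\<lambda>\<omega>. W (u (Suc n)) \<omega> - W (u n) \<omega>"
  have meas: "f \<in> borel_measurable (F (u n))" "?b \<in> borel_measurable (F (u n))"
  proof -
    show "f \<in> borel_measurable (F (u n))" using measurable_F_mono[OF f u(1)] mono by auto
    have "b \<in> borel_measurable (F (u n))" using measurable_F_mono[OF b u(1)] mono by auto
    then show "?b \<in> borel_measurable (F (u n))"
      by (intro borel_measurable_add borel_measurable_sum borel_measurable_times borel_measurable_diff
          borel_measurable_const W_measurable_F nonneg mono) auto
  qed
  have D: "distributed M lborel ?D (normal_density 0 (sqrt (u (Suc n) - u n)))"
    "indep_set (sets (F (u n))) (sets (vimage_algebra (space M) ?D borel))"
    using bm u(2)[of n] nonneg[of n] unfolding brownian_motion_def by blast+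
  have "(\<integral>\<^sup>+\<omega>. f \<omega> * ennreal (heat_kernel \<epsilon> (b \<omega> + (\<Sum>i<Suc n. \<kappa> i * (W (u (Suc i)) \<omega> - W (u i) \<omega>)))) \<partial>M) =
      (\<integral>\<^sup>+\<omega>. f \<omega> * ennreal (heat_kernel \<epsilon> (?b \<omega> + \<kappa> n * ?D \<omega>)) \<partial>M)"
    by (simp add: add.assoc)
  also have "\<dots> = (\<integral>\<^sup>+\<omega>. f \<omega> * ennreal (heat_kernel (\<epsilon> + (\<kappa> n)\<^sup>2 * (sqrt (u (Suc n) - u n))\<^sup>2) (?b \<omega>)) \<partial>M)"
    using u(2)[of n] Suc.prems
    by (intro nn_integral_heat_kernel_indep_normal[OF subalgebra_F[OF nonneg] D(2) D(1) _ \<kappa> _ meas]) auto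
  also have "\<dots> = (\<integral>\<^sup>+\<omega>. f \<omega> * ennreal (heat_kernel (\<epsilon> + (\<kappa> n)\<^sup>2 * (u (Suc n) - u n)
      + (\<Sum>i<n. (\<kappa> i)\<^sup>2 * (u (Suc i) - u i))) (b \<omega>)) \<partial>M)"
    using u(2)[of n] Suc.prems
    by (subst Suc.IH[symmetric]) (auto intro!: add_pos_nonneg)
  finally show ?case by (simp add: ac_simps)
qed simp

end

section \<open>The clock and the solution as limits of weighted sums\<close>

lemma uniformly_close_on_Icc:
  fixes f :: "real \<Rightarrow> real"
  assumes "continuous_on {s..r} f" "0 < e"
  obtains \<delta> where "0 < \<delta>" "\<And>a b. a \<in> {s..r} \<Longrightarrow> b \<in> {s..r} \<Longrightarrow> \<bar>a - b\<bar> < \<delta> \<Longrightarrow> \<bar>f a - f b\<bar> < e"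
proof -
  have "uniformly_continuous_on {s..r} f"
    using assms(1) by (intro compact_uniformly_continuous) auto
  then show ?thesis
    using that \<open>0 < e\<close> unfolding uniformly_continuous_on_def dist_real_def by metis
qed

lemma bounded_on_Icc:
  fixes f :: "real \<Rightarrow> real"
  assumes "continuous_on {s..r} f"
  obtains K where "0 < K" "\<And>a. a \<in> {s..r} \<Longrightarrow> \<bar>f a\<bar> \<le> K"
proof -
  have "bounded (f ` {s..r})"
    by (rule compact_imp_bounded, rule compact_continuous_image[OF assms]) simp
  then show ?thesis
    using that unfolding bounded_pos by (metis imageI real_norm_def)
qed

context coercive_drift
begin

text \<open>By the mean value theorem an increment of the clock is the step length times
  \<open>exp (2 * A z)\<close> at an intermediate point, and uniform continuity replaces that point
  by the left endpoint.\<close>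

lemma clock_sum_limit:
  assumes "0 \<le> s" "s < r"
  defines "p \<equiv> \<lambda>n i. s + real i * (r - s) / real (Suc n)"
  shows "(\<lambda>n. \<Sum>i<Suc n. exp (2 * A (p n i)) * (p n (Suc i) - p n i)) \<longlonglongrightarrow> clock r - clock s"
  unfolding p_def
proof (rule telescoping_sum_limit[OF \<open>s < r\<close>, where \<phi> = "\<lambda>u u'. exp (2 * A u) * (u' - u)"])
  fix \<eta> :: real assume "0 < \<eta>"
  obtain \<delta> where \<delta>: "0 < \<delta>" "\<And>a b. a \<in> {s..r} \<Longrightarrow> b \<in> {s..r} \<Longrightarrow> \<bar>a - b\<bar> < \<delta> \<Longrightarrow>
      \<bar>exp (2 * A a) - exp (2 * A b)\<bar> < \<eta>"
    using uniformly_close_on_Icc[OF cont_exp_A \<open>0 < \<eta>\<close>] by blast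
  show "\<exists>\<delta>>0. \<forall>u u'. s \<le> u \<longrightarrow> u < u' \<longrightarrow> u' \<le> r \<longrightarrow> u' - u < \<delta> \<longrightarrow>
      \<bar>clock u' - clock u - exp (2 * A u) * (u' - u)\<bar> \<le> \<eta> * (u' - u)"
  proof (intro exI conjI allI impI, rule \<delta>(1))
    fix u u' assume u: "s \<le> u" "u < u'" "u' \<le> r" "u' - u < \<delta>"
    have deriv: "(clock has_real_derivative exp (2 * A z)) (at z)" if "u < z" for z
      using that u \<open>0 \<le> s\<close> by (intro clock_deriv_at) auto
    moreover have "continuous_on {u..u'} clock" by (rule continuous_on_subset[OF cont_clock]) simp
    ultimately obtain l z where z: "u < z" "z < u'" "(clock has_real_derivative l) (at z)" "clock u' - clock u = (u' - u) * l"
      using MVT[of u u' clock] u by (metis real_differentiable_def)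
    have l: "l = exp (2 * A z)"
      using DERIV_unique[OF z(3) deriv[OF z(1)]] .
    have "clock u' - clock u - exp (2 * A u) * (u' - u) = (exp (2 * A z) - exp (2 * A u)) * (u' - u)"
      unfolding z(4) l by (simp add: algebra_simps)
    then have "\<bar>clock u' - clock u - exp (2 * A u) * (u' - u)\<bar> = \<bar>exp (2 * A z) - exp (2 * A u)\<bar> * (u' - u)"
      using u by (simp add: abs_mult)
    also have "\<dots> \<le> \<eta> * (u' - u)"
      using \<delta>(2)[of z u] u z by (intro mult_right_mono) auto
    finally show "\<bar>clock u' - clock u - exp (2 * A u) * (u' - u)\<bar> \<le> \<eta> * (u' - u)" .
  qed
qed

text \<open>This is d(exp(A) x) = exp(A) dw for one fixed path: the integrating factor cancels the
  drift. The integrand is deterministic and smooth enough for plain Riemann-Stieltjes sums, so a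
  pathwise argument suffices.\<close>

lemma solution_sum_limit:
  fixes x w :: "real \<Rightarrow> real"
  assumes "0 \<le> s" "s < r"
    and x: "continuous_on {0..} x"
    and eq: "\<And>t. 0 \<le> t \<Longrightarrow> x t = integral {0..t} (\<lambda>u. - \<alpha> u * x u) + w t"
  defines "p \<equiv> \<lambda>n i. s + real i * (r - s) / real (Suc n)"
  shows "(\<lambda>n. \<Sum>i<Suc n. exp (A (p n i)) * (w (p n (Suc i)) - w (p n i)))
    \<longlonglongrightarrow> exp (A r) * x r - exp (A s) * x s"
  unfolding p_def
proof (rule telescoping_sum_limit[OF \<open>s < r\<close>, where \<phi> = "\<lambda>u u'. exp (A u) * (w u' - w u)" and \<Phi> = "\<lambda>u. exp (A u) * x u"])
  fix \<eta> :: real assume "0 < \<eta>"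
  define I where "I t = integral {0..t} (\<lambda>u. - \<alpha> u * x u)" for t
  have I_deriv: "(I has_real_derivative - \<alpha> t * x t) (at t within {0..})" if "0 \<le> t" for t
    unfolding I_def[abs_def] using that
    by (intro integral_has_real_derivative_atLeast continuous_intros x cont_drift)
  have sub: "{s..r} \<subseteq> {0..}" using \<open>0 \<le> s\<close> by auto
  have cont: "continuous_on {s..r} x" "continuous_on {s..r} \<alpha>" "continuous_on {s..r} (\<lambda>u. exp (A u))"
    using x cont_drift cont_exp_A[of "{s..r}" 1] sub by (auto intro: continuous_on_subset)
  obtain K1 K2 K3 where "0 < K1" "0 < K2" "0 < K3"
    and K': "\<And>a. a \<in> {s..r} \<Longrightarrow> \<bar>x a\<bar> \<le> K1" "\<And>a. a \<in> {s..r} \<Longrightarrow> \<bar>\<alpha> a\<bar> \<le> K2"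
      "\<And>a. a \<in> {s..r} \<Longrightarrow> \<bar>exp (A a)\<bar> \<le> K3"
    using bounded_on_Icc[OF cont(1)] bounded_on_Icc[OF cont(2)] bounded_on_Icc[OF cont(3)] by metis
  define K where "K = K1 + K2 + K3"
  have K: "\<bar>x a\<bar> \<le> K" "\<bar>\<alpha> a\<bar> \<le> K" "exp (A a) \<le> K" if "a \<in> {s..r}" for a
    using K'(1)[OF that] K'(2)[OF that] K'(3)[OF that] \<open>0 < K1\<close> \<open>0 < K2\<close> \<open>0 < K3\<close> by (auto simp: K_def)
  \<comment> \<open>The derivative below is bounded by \<open>K * (e * K + e * K)\<close>, which
    equals \<eta> for this \<open>e\<close>.\<close>
  define e where "e = \<eta> / (2 * K * K)"
  have "0 < K" by (simp add: K_def \<open>0 < K1\<close> \<open>0 < K2\<close> \<open>0 < K3\<close> add_pos_pos)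
  then have "0 < e" using \<open>0 < \<eta>\<close> by (simp add: e_def)
  obtain \<delta>1 where \<delta>1: "0 < \<delta>1" "\<And>a b. a \<in> {s..r} \<Longrightarrow> b \<in> {s..r} \<Longrightarrow> \<bar>a - b\<bar> < \<delta>1 \<Longrightarrow> \<bar>x a - x b\<bar> < e"
    using uniformly_close_on_Icc[OF cont(1) \<open>0 < e\<close>] by blast
  obtain \<delta>2 where \<delta>2: "0 < \<delta>2" "\<And>a b. a \<in> {s..r} \<Longrightarrow> b \<in> {s..r} \<Longrightarrow> \<bar>a - b\<bar> < \<delta>2 \<Longrightarrow> \<bar>exp (A a) - exp (A b)\<bar> < e"
    using uniformly_close_on_Icc[OF cont(3) \<open>0 < e\<close>] by blast
  show "\<exists>\<delta>>0. \<forall>u u'. s \<le> u \<longrightarrow> u < u' \<longrightarrow> u' \<le> r \<longrightarrow> u' - u < \<delta> \<longrightarrow>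
      \<bar>exp (A u') * x u' - exp (A u) * x u - exp (A u) * (w u' - w u)\<bar> \<le> \<eta> * (u' - u)"
  proof (intro exI[of _ "min \<delta>1 \<delta>2"] conjI allI impI)
    fix u u' assume u: "s \<le> u" "u < u'" "u' \<le> r" "u' - u < min \<delta>1 \<delta>2"
    \<comment> \<open>The path \<open>x\<close> is only continuous, so the mean value theorem cannot
      be applied to the error directly. Freezing \<open>x u'\<close> and \<open>exp (A u)\<close>
      gives a differentiable function whose increment from \<open>u\<close> to \<open>u'\<close> is
      exactly the local error, with a derivative that is small because \<open>u\<close>,
      \<open>z\<close> and \<open>u'\<close> are close.\<close>
    define \<Psi> where "\<Psi> z = x u' * exp (A z) + exp (A u) * I z" for z
    have "continuous_on {0..} (\<lambda>u. - \<alpha> u * x u)"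
      by (intro continuous_intros x cont_drift)
    then have cont_I: "continuous_on {u..u'} I"
      unfolding I_def[abs_def] by (rule continuous_on_subset[OF integral_continuous_on_UNIV]) simp
    have deriv: "(\<Psi> has_real_derivative (\<alpha> z * (x u' * exp (A z) - exp (A u) * x z))) (at z)" if z: "u < z" "z < u'" for z
    proof -
      have "0 < z" using z u \<open>0 \<le> s\<close> by auto
      then have "(A has_real_derivative \<alpha> z) (at z)" "(I has_real_derivative - \<alpha> z * x z) (at z)"
        using A_deriv[of z] I_deriv[of z] by (auto simp: at_within_interior_atLeast)
      then show ?thesis
        unfolding \<Psi>_def by (auto intro!: derivative_eq_intros simp: algebra_simps)
    qed
    have "continuous_on {u..u'} \<Psi>"
      unfolding \<Psi>_def using cont_exp_A[of "{u..u'}" 1] by (auto intro!: continuous_intros cont_I)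
    then obtain l z where z: "u < z" "z < u'" "(\<Psi> has_real_derivative l) (at z)" "\<Psi> u' - \<Psi> u = (u' - u) * l"
      using MVT[of u u' \<Psi>] u deriv by (metis real_differentiable_def)
    have l: "l = \<alpha> z * (x u' * exp (A z) - exp (A u) * x z)"
      using DERIV_unique[OF z(3) deriv[OF z(1,2)]] .
    have in_I: "z \<in> {s..r}" "u \<in> {s..r}" "u' \<in> {s..r}" using z u by auto
    have "x u' * exp (A z) - exp (A u) * x z = (x u' - x z) * exp (A z) + (exp (A z) - exp (A u)) * x z"
      by (simp add: algebra_simps)
    then have "\<bar>x u' * exp (A z) - exp (A u) * x z\<bar> \<le> \<bar>(x u' - x z) * exp (A z)\<bar> + \<bar>(exp (A z) - exp (A u)) * x z\<bar>"
      by (simp only: abs_triangle_ineq)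
    also have "\<dots> = \<bar>x u' - x z\<bar> * exp (A z) + \<bar>exp (A z) - exp (A u)\<bar> * \<bar>x z\<bar>"
      by (simp add: abs_mult)
    also have "\<dots> \<le> e * K + e * K"
      using \<delta>1(2)[of u' z] \<delta>2(2)[of z u] in_I z u K[of z] \<open>0 < e\<close> by (intro add_mono mult_mono) auto
    finally have "\<bar>l\<bar> \<le> K * (e * K + e * K)"
      unfolding l abs_mult using K(2)[of z] in_I \<open>0 < K\<close> by (intro mult_mono) auto
    also have "\<dots> = \<eta>" using \<open>0 < K\<close> by (simp add: e_def field_simps)
    finally have "\<bar>l\<bar> \<le> \<eta>" .
    have w_eq: "w u' - w u = x u' - x u - (I u' - I u)"
      using eq[of u] eq[of u'] u \<open>0 \<le> s\<close> unfolding I_def by simp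
    have "exp (A u') * x u' - exp (A u) * x u - exp (A u) * (w u' - w u) = \<Psi> u' - \<Psi> u"
      unfolding \<Psi>_def w_eq by (simp add: algebra_simps)
    with \<open>\<bar>l\<bar> \<le> \<eta>\<close> show "\<bar>exp (A u') * x u' - exp (A u) * x u - exp (A u) * (w u' - w u)\<bar> \<le> \<eta> * (u' - u)"
      using u unfolding z(4) by (simp add: abs_mult mult.commute)
  qed (use \<delta>1 \<delta>2 in auto)
qed

end

section \<open>The process and its Gaussian innovation\<close>

text \<open>Continuity is demanded of every path, not just of almost every one, so that joint
  measurability in time and \<omega> can be proved without exceptional sets. A solution is brought
  into this form by changing it on a null set.\<close>

locale ou_process = brownian M F W + coercive_drift \<alpha> c
  for M :: "'a measure" and F W \<alpha> c +
  fixes X :: "real \<Rightarrow> 'a \<Rightarrow> real"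
  assumes X_F: "\<And>t. 0 \<le> t \<Longrightarrow> X t \<in> borel_measurable (F t)"
    and X_cont: "\<And>\<omega>. continuous_on {0..} (\<lambda>t. X t \<omega>)"
    and X_0: "AE \<omega> in M. X 0 \<omega> = 0"
    and X_eq: "AE \<omega> in M. \<forall>t\<ge>0. X t \<omega> = integral {0..t} (\<lambda>u. - \<alpha> u * X u \<omega>) + W t \<omega>"
begin

lemma X_measurable: "0 \<le> t \<Longrightarrow> X t \<in> borel_measurable M"
  using X_F subalgebra_F measurable_from_subalg by blast

text \<open>
  The innovation is the a.s. limit of sums of weighted Brownian increments, each of which adds its
  variance to the parameter of the heat kernel.
\<close>

lemma nn_integral_heat_kernel_innovation:
  assumes s: "0 \<le> s" "s < r" and "0 < \<epsilon>"
    and f: "f \<in> borel_measurable (F s)" "\<And>\<omega>. 0 \<le> f \<omega>" "\<And>\<omega>. f \<omega> \<le> K"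
    and b: "b \<in> borel_measurable (F s)"
  shows "(\<integral>\<^sup>+\<omega>. ennreal (f \<omega> * heat_kernel \<epsilon> (b \<omega> + (X r \<omega> - exp (A s - A r) * X s \<omega>))) \<partial>M) =
    (\<integral>\<^sup>+\<omega>. ennreal (f \<omega> * heat_kernel (\<epsilon> + (clock r - clock s) / exp (2 * A r)) (b \<omega>)) \<partial>M)"
proof -
  define p where "p n i = s + real i * (r - s) / real (Suc n)" for n i
  \<comment> \<open>With these weights \<open>S\<close> discretises exp(-A(r)) times the integral of
    exp(A) dW from \<open>s\<close> to \<open>r\<close>, which is the innovation
    \<open>Y\<close>.\<close>
  define \<kappa> where "\<kappa> n i = exp (A (p n i) - A r)" for n i
  define S where "S n \<omega> = (\<Sum>i<Suc n. \<kappa> n i * (W (p n (Suc i)) \<omega> - W (p n i) \<omega>))" for n \<omega>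
  define V where "V n = (\<Sum>i<Suc n. (\<kappa> n i)\<^sup>2 * (p n (Suc i) - p n i))" for n
  define Y where "Y \<omega> = X r \<omega> - exp (A s - A r) * X s \<omega>" for \<omega>
  define V\<^sub>0 where "V\<^sub>0 = (clock r - clock s) / exp (2 * A r)"
  have p: "p n 0 = s" "p n i < p n (Suc i)" "0 \<le> p n i" for n i
    using s by (auto simp: p_def divide_strict_right_mono)
  have fM [measurable]: "f \<in> borel_measurable M" and bM [measurable]: "b \<in> borel_measurable M"
    using f(1) b subalgebra_F[OF s(1)] by (auto intro: measurable_from_subalg)
  have WM [measurable]: "W (p n i) \<in> borel_measurable M" for n i
    using W_measurable_F[OF p(3) order_refl] subalgebra_F[OF p(3)] measurable_from_subalg by blast
  have SM [measurable]: "S n \<in> borel_measurable M" for n unfolding S_def[abs_def] by measurable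
  have YM [measurable]: "Y \<in> borel_measurable M"
    using s unfolding Y_def[abs_def]
    by (intro borel_measurable_diff borel_measurable_times borel_measurable_const X_measurable) auto
  have K: "0 \<le> K" using f(2,3) order_trans by blast
  have V_nonneg: "0 \<le> V n" for n
    unfolding V_def using p(2) by (intro sum_nonneg mult_nonneg_nonneg) (auto intro: less_imp_le)
  have V0: "0 \<le> V\<^sub>0" using clock_less[OF s] by (simp add: V\<^sub>0_def)
  have V_lim: "V \<longlonglongrightarrow> V\<^sub>0"
  proof -
    have "V = (\<lambda>n. (\<Sum>i<Suc n. exp (2 * A (p n i)) * (p n (Suc i) - p n i)) / exp (2 * A r))"
      unfolding V_def \<kappa>_def sum_divide_distrib
      by (intro ext sum.cong refl) (simp add: exp_diff power_divide exp_double)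
    then show ?thesis
      unfolding V\<^sub>0_def using clock_sum_limit[OF s] by (auto simp: p_def intro!: tendsto_divide)
  qed
  have S_lim: "AE \<omega> in M. (\<lambda>n. S n \<omega>) \<longlonglongrightarrow> Y \<omega>"
    using X_eq
  proof eventually_elim
    case (elim \<omega>)
    have "(\<lambda>n. (\<Sum>i<Suc n. exp (A (p n i)) * (W (p n (Suc i)) \<omega> - W (p n i) \<omega>)) / exp (A r)) \<longlonglongrightarrow>
        (exp (A r) * X r \<omega> - exp (A s) * X s \<omega>) / exp (A r)"
      unfolding p_def using elim
      by (intro tendsto_divide solution_sum_limit[OF s X_cont] tendsto_const) auto
    moreover have "(\<Sum>i<Suc n. exp (A (p n i)) * (W (p n (Suc i)) \<omega> - W (p n i) \<omega>)) / exp (A r) = S n \<omega>" for n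
      unfolding S_def \<kappa>_def sum_divide_distrib by (intro sum.cong refl) (simp add: exp_diff)
    moreover have "(exp (A r) * X r \<omega> - exp (A s) * X s \<omega>) / exp (A r) = Y \<omega>"
      by (simp add: Y_def exp_diff field_simps)
    ultimately show ?case by simp
  qed
  \<comment> \<open>One constant dominates both sequences of integrands: \<open>f\<close> is at most
    \<open>K\<close>, and enlarging the parameter of a heat kernel lowers its maximum.\<close>
  let ?B = "\<lambda>\<omega>. ennreal (K * (1 / sqrt (2 * pi * \<epsilon>)))"
  have le_B: "ennreal (f \<omega> * heat_kernel (\<epsilon> + v) y) \<le> ?B \<omega>" if "0 \<le> v" for \<omega> y v
  proof -
    have "heat_kernel (\<epsilon> + v) y \<le> 1 / sqrt (2 * pi * (\<epsilon> + v))"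
      using that \<open>0 < \<epsilon>\<close> by (intro heat_kernel_le) auto
    also have "\<dots> \<le> 1 / sqrt (2 * pi * \<epsilon>)"
      using that \<open>0 < \<epsilon>\<close> by (intro divide_left_mono) (auto intro!: mult_left_mono)
    finally show ?thesis
      using f(2,3) K that \<open>0 < \<epsilon>\<close> by (intro ennreal_leI mult_mono heat_kernel_nonneg) auto
  qed
  have B_fin: "(\<integral>\<^sup>+\<omega>. ?B \<omega> \<partial>M) < \<infinity>" by (simp add: emeasure_space_1)
  \<comment> \<open>For each \<open>n\<close> the identity is known with \<open>S n\<close> and
    \<open>V n\<close>. It passes to the limit by dominated convergence on both sides: on the left
    the argument of the kernel converges, on the right its parameter.\<close>
  have "(\<lambda>n. \<integral>\<^sup>+\<omega>. ennreal (f \<omega> * heat_kernel \<epsilon> (b \<omega> + S n \<omega>)) \<partial>M) \<longlonglongrightarrow>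
      (\<integral>\<^sup>+\<omega>. ennreal (f \<omega> * heat_kernel \<epsilon> (b \<omega> + Y \<omega>)) \<partial>M)"
  proof (rule nn_integral_dominated_convergence[where w = ?B])
    show "AE \<omega> in M. (\<lambda>n. ennreal (f \<omega> * heat_kernel \<epsilon> (b \<omega> + S n \<omega>))) \<longlonglongrightarrow> ennreal (f \<omega> * heat_kernel \<epsilon> (b \<omega> + Y \<omega>))"
      using S_lim
      by eventually_elim
        (intro tendsto_ennrealI tendsto_mult tendsto_const isCont_tendsto_compose[OF isCont_heat_kernel] tendsto_add)
  qed (use le_B[of 0] B_fin in auto)
  moreover have "(\<lambda>n. \<integral>\<^sup>+\<omega>. ennreal (f \<omega> * heat_kernel (\<epsilon> + V n) (b \<omega>)) \<partial>M) \<longlonglongrightarrow>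
      (\<integral>\<^sup>+\<omega>. ennreal (f \<omega> * heat_kernel (\<epsilon> + V\<^sub>0) (b \<omega>)) \<partial>M)"
  proof (rule nn_integral_dominated_convergence[where w = ?B])
    have "(\<lambda>n. heat_kernel (\<epsilon> + V n) y) \<longlonglongrightarrow> heat_kernel (\<epsilon> + V\<^sub>0) y" for y
      unfolding heat_kernel_def using \<open>0 < \<epsilon>\<close> V0
      by (intro tendsto_intros V_lim) (auto simp: add_nonneg_eq_0_iff)
    then show "AE \<omega> in M. (\<lambda>n. ennreal (f \<omega> * heat_kernel (\<epsilon> + V n) (b \<omega>))) \<longlonglongrightarrow> ennreal (f \<omega> * heat_kernel (\<epsilon> + V\<^sub>0) (b \<omega>))"
      by (intro AE_I2 tendsto_ennrealI tendsto_mult tendsto_const)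
  qed (use le_B V_nonneg B_fin in auto)
  moreover have "(\<integral>\<^sup>+\<omega>. ennreal (f \<omega> * heat_kernel \<epsilon> (b \<omega> + S n \<omega>)) \<partial>M) =
      (\<integral>\<^sup>+\<omega>. ennreal (f \<omega> * heat_kernel (\<epsilon> + V n) (b \<omega>)) \<partial>M)" for n
    using nn_integral_heat_kernel_increments[of "p n" "\<kappa> n" "\<lambda>\<omega>. ennreal (f \<omega>)" b \<epsilon> "Suc n"] f b p s(1) \<open>0 < \<epsilon>\<close> V_nonneg[of n]
    by (simp add: S_def V_def \<kappa>_def ennreal_mult heat_kernel_nonneg)
  ultimately show ?thesis
    unfolding Y_def V\<^sub>0_def using LIMSEQ_unique by simp
qed

end

section \<open>One-point and two-point expectations\<close>

lemma sqrt_two_pi_mult: "sqrt (2 * pi * a) * sqrt (2 * pi * b) = 2 * pi * sqrt (a * b)"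
proof -
  have "sqrt (2 * pi * a) * sqrt (2 * pi * b) = sqrt ((2 * pi)\<^sup>2 * (a * b))"
    by (simp add: real_sqrt_mult[symmetric] power2_eq_square ac_simps)
  then show ?thesis by (simp only: real_sqrt_mult real_sqrt_abs) simp
qed

text \<open>It will be used with \<open>d\<close> the squared covariance, \<open>a\<^sub>0\<close>
  the product of the variances and \<open>a\<close> the product of the variances enlarged by
  \<epsilon>. The first summand then yields the product of the means, and the second bounds the
  covariance without \<epsilon>. With \<open>x = sqrt a\<close> and \<open>y = sqrt (a - d)\<close>
  the difference is \<open>d / (x * y * (x + y))\<close>, and decreasing the denominator gives the
  bound.\<close>

lemma inverse_sqrt_diff_le:
  fixes a a\<^sub>0 d :: real
  assumes "0 \<le> d" "d < a\<^sub>0" "a\<^sub>0 \<le> a"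
  shows "1 / sqrt (a - d) \<le> 1 / sqrt a + d / a\<^sub>0 / sqrt (1 - d / a\<^sub>0) / sqrt a\<^sub>0"
proof -
  define x y where "x = sqrt a" and "y = sqrt (a - d)"
  have xy: "0 < y" "y \<le> x" "d = x\<^sup>2 - y\<^sup>2" "0 < x" "x\<^sup>2 = a" using assms by (auto simp: x_def y_def)
  have "d = (x - y) * (x + y)" using xy by (simp add: power2_eq_square algebra_simps)
  then have "1 / y - 1 / x = d / (x * y * (x + y))"
    using xy(1,2,4) by (simp add: diff_frac_eq mult.commute)
  also have "\<dots> \<le> d / (x * y * x)"
    using xy assms by (intro divide_left_mono) auto
  also have "\<dots> = d / (a * y)" using xy by (simp add: power2_eq_square ac_simps)
  also have "\<dots> \<le> d / (a\<^sub>0 * sqrt (a\<^sub>0 - d))"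
    using assms unfolding y_def by (intro divide_left_mono mult_mono) auto
  also have "sqrt (a\<^sub>0 - d) = sqrt (1 - d / a\<^sub>0) * sqrt a\<^sub>0"
    using assms by (simp add: real_sqrt_mult[symmetric] field_simps)
  finally show ?thesis by (simp add: x_def y_def field_simps)
qed

lemma inverse_sqrt_mult_le:
  fixes v w :: real
  assumes "0 < v" "0 < w"
  shows "1 / sqrt (v * w) \<le> (1 / v + 1 / w) / 2"
  using arith_geo_mean_sqrt[of "1 / v" "1 / w"] assms by (simp add: real_sqrt_divide real_sqrt_mult)

context ou_process
begin

text \<open>The process starts at 0, so its value at time \<open>r\<close> is its own innovation
  since time 0.\<close>

lemma nn_integral_heat_kernel_X:
  assumes "0 < r" "0 < \<epsilon>"
  shows "(\<integral>\<^sup>+\<omega>. ennreal (heat_kernel \<epsilon> (X r \<omega>)) \<partial>M) = ennreal (heat_kernel (\<epsilon> + var r) 0)"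
proof -
  have "(\<integral>\<^sup>+\<omega>. ennreal (heat_kernel \<epsilon> (X r \<omega>)) \<partial>M) =
      (\<integral>\<^sup>+\<omega>. ennreal (1 * heat_kernel \<epsilon> (0 + (X r \<omega> - exp (A 0 - A r) * X 0 \<omega>))) \<partial>M)"
    by (rule nn_integral_cong_AE) (use X_0 in eventually_elim, simp)
  also have "\<dots> = (\<integral>\<^sup>+\<omega>. ennreal (1 * heat_kernel (\<epsilon> + (clock r - clock 0) / exp (2 * A r)) 0) \<partial>M)"
    using assms by (intro nn_integral_heat_kernel_innovation[where K = 1]) auto
  finally show ?thesis by (simp add: var_def emeasure_space_1)
qed

text \<open>Here \<open>d\<close> is the squared covariance of the two values. The right-hand side
  is the density at the origin of the Gaussian pair after independent noise of variance \<epsilon>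
  is added to each coordinate, and the expression under the root is its covariance
  determinant.\<close>

lemma nn_integral_heat_kernel_X_X:
  assumes "0 < s" "s < r" "0 < \<epsilon>"
  defines "d \<equiv> exp (2 * (A s - A r)) * (var s)\<^sup>2"
  shows "(\<integral>\<^sup>+\<omega>. ennreal (heat_kernel \<epsilon> (X s \<omega>) * heat_kernel \<epsilon> (X r \<omega>)) \<partial>M) =
    ennreal (1 / (2 * pi * sqrt ((\<epsilon> + var s) * (\<epsilon> + var r) - d)))"
proof -
  define \<kappa> where "\<kappa> = exp (A s - A r)"
  define w where "w = \<epsilon> + (clock r - clock s) / exp (2 * A r)"
  \<comment> \<open>Once the innovation is averaged out, both kernels depend on \<open>X s\<close>
    alone. Their product is a Gaussian in that variable whose parameter satisfies 1/h = 1/\<epsilon>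
    + \<kappa>^2/w.\<close>
  define h where "h = \<epsilon> * w / (w + \<kappa>\<^sup>2 * \<epsilon>)"
  have "0 < w" using clock_less[of s r] assms by (auto simp: w_def intro!: add_pos_nonneg)
  have "0 < \<kappa>" by (simp add: \<kappa>_def)
  have "0 < w + \<kappa>\<^sup>2 * \<epsilon>" using \<open>0 < w\<close> \<open>0 < \<epsilon>\<close> by (auto intro!: add_pos_nonneg)
  then have "0 < h" using \<open>0 < w\<close> \<open>0 < \<epsilon>\<close> by (simp add: h_def)
  have var_r: "\<epsilon> + var r = w + \<kappa>\<^sup>2 * var s"
    unfolding var_def w_def \<kappa>_def
    by (simp add: exp_diff power_divide exp_double field_simps)
  have Xs: "X s \<in> borel_measurable (F s)" using X_F[of s] assms by simp
  have "(\<integral>\<^sup>+\<omega>. ennreal (heat_kernel \<epsilon> (X s \<omega>) * heat_kernel \<epsilon> (X r \<omega>)) \<partial>M) =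
      (\<integral>\<^sup>+\<omega>. ennreal (heat_kernel \<epsilon> (X s \<omega>) * heat_kernel \<epsilon> (\<kappa> * X s \<omega> + (X r \<omega> - exp (A s - A r) * X s \<omega>))) \<partial>M)"
    by (simp add: \<kappa>_def)
  also have "\<dots> = (\<integral>\<^sup>+\<omega>. ennreal (heat_kernel \<epsilon> (X s \<omega>) * heat_kernel w (\<kappa> * X s \<omega>)) \<partial>M)"
    unfolding w_def using assms Xs
    by (intro nn_integral_heat_kernel_innovation[where K = "1 / sqrt (2 * pi * \<epsilon>)"] heat_kernel_nonneg heat_kernel_le) auto
  also have "\<dots> = (\<integral>\<^sup>+\<omega>. ennreal (1 / sqrt (2 * pi * (w + \<kappa>\<^sup>2 * \<epsilon>))) * ennreal (heat_kernel h (X s \<omega>)) \<partial>M)"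
  proof (rule nn_integral_cong)
    fix \<omega>
    have "heat_kernel \<epsilon> y * heat_kernel w (\<kappa> * y) = 1 / sqrt (2 * pi * (w + \<kappa>\<^sup>2 * \<epsilon>)) * heat_kernel h y" for y
    proof -
      have "- y\<^sup>2 / (2 * \<epsilon>) + - (\<kappa> * y)\<^sup>2 / (2 * w) = - y\<^sup>2 / (2 * h)"
        using \<open>0 < w\<close> \<open>0 < \<epsilon>\<close> \<open>0 < w + \<kappa>\<^sup>2 * \<epsilon>\<close> unfolding h_def by (simp add: field_simps)
      moreover have "sqrt (2 * pi * \<epsilon>) * sqrt (2 * pi * w) = sqrt (2 * pi * (w + \<kappa>\<^sup>2 * \<epsilon>)) * sqrt (2 * pi * h)"
        using \<open>0 < w + \<kappa>\<^sup>2 * \<epsilon>\<close> unfolding h_def by (simp add: real_sqrt_mult[symmetric] field_simps)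
      ultimately show ?thesis
        unfolding heat_kernel_def by (simp add: exp_add[symmetric] mult.assoc)
    qed
    then show "ennreal (heat_kernel \<epsilon> (X s \<omega>) * heat_kernel w (\<kappa> * X s \<omega>)) =
        ennreal (1 / sqrt (2 * pi * (w + \<kappa>\<^sup>2 * \<epsilon>))) * ennreal (heat_kernel h (X s \<omega>))"
      using \<open>0 < w + \<kappa>\<^sup>2 * \<epsilon>\<close> \<open>0 < h\<close> by (subst ennreal_mult[symmetric]) (auto simp: heat_kernel_nonneg)
  qed
  also have "\<dots> = ennreal (1 / sqrt (2 * pi * (w + \<kappa>\<^sup>2 * \<epsilon>))) * ennreal (heat_kernel (h + var s) 0)"
    using assms \<open>0 < h\<close> X_measurable[of s]
    by (subst nn_integral_cmult) (auto simp: nn_integral_heat_kernel_X)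
  also have "\<dots> = ennreal (1 / (2 * pi * sqrt ((\<epsilon> + var s) * (\<epsilon> + var r) - d)))"
  proof -
    have "(w + \<kappa>\<^sup>2 * \<epsilon>) * (h + var s) = (\<epsilon> + var s) * (\<epsilon> + var r) - d"
    proof -
      have "d = \<kappa>\<^sup>2 * (var s)\<^sup>2" by (simp only: d_def \<kappa>_def exp_double)
      moreover have "(w + \<kappa>\<^sup>2 * \<epsilon>) * h = \<epsilon> * w" using \<open>0 < w + \<kappa>\<^sup>2 * \<epsilon>\<close> by (simp add: h_def)
      ultimately show ?thesis unfolding var_r by (simp add: algebra_simps power2_eq_square)
    qed
    then show ?thesis
      using \<open>0 < w + \<kappa>\<^sup>2 * \<epsilon>\<close> \<open>0 < h\<close> var_pos[of s] assms(1) sqrt_two_pi_mult[of "w + \<kappa>\<^sup>2 * \<epsilon>" "h + var s"]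
      by (subst ennreal_mult[symmetric]) (auto simp: heat_kernel_0)
  qed
  finally show ?thesis .
qed

text \<open>Beyond the product of the one-point expectations there remains a covariance bound that
  is uniform in \<epsilon>. Both orders of the arguments of \<open>corr\<close> occur because the
  AM-GM bound produces \<open>1 / var s\<close> as well as \<open>1 / var r\<close>.\<close>

lemma nn_integral_heat_kernel_X_X_le_less:
  assumes "0 < s" "s < r" "0 < \<epsilon>"
  shows "(\<integral>\<^sup>+\<omega>. ennreal (heat_kernel \<epsilon> (X s \<omega>) * heat_kernel \<epsilon> (X r \<omega>)) \<partial>M) \<le>
    ennreal (heat_kernel (\<epsilon> + var s) 0 * heat_kernel (\<epsilon> + var r) 0 + (corr s r + corr r s) / (4 * pi))"
proof -
  define d where "d = exp (2 * (A s - A r)) * (var s)\<^sup>2"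
  define q where "q = clock s / clock r"
  have v: "0 < var s" "0 < var r" using var_pos assms by auto
  have cl: "0 < clock s" "0 < clock r" "clock s < clock r" using clock_pos clock_less assms by auto
  have q: "d / (var s * var r) = q" "0 < q" "q < 1"
    using cl by (auto simp: d_def var_def q_def field_simps power2_eq_square exp_diff)
  then have d: "d = q * (var s * var r)" using v by (simp add: field_simps)
  have d': "0 \<le> d" "d < var s * var r" using q v unfolding d by auto
  have corr: "corr s r = q / sqrt (1 - q) / var r" "corr r s = q / sqrt (1 - q) / var s"
    using assms by (simp_all add: corr_def Let_def q_def var_def min_def max_def ac_simps)
  have "1 / sqrt ((\<epsilon> + var s) * (\<epsilon> + var r) - d) \<le>
      1 / sqrt ((\<epsilon> + var s) * (\<epsilon> + var r)) + q / sqrt (1 - q) * (1 / sqrt (var s * var r))"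
    using inverse_sqrt_diff_le[of d "var s * var r" "(\<epsilon> + var s) * (\<epsilon> + var r)"] d' q v \<open>0 < \<epsilon>\<close>
    by (simp add: mult_mono)
  also have "q / sqrt (1 - q) * (1 / sqrt (var s * var r)) \<le> q / sqrt (1 - q) * ((1 / var s + 1 / var r) / 2)"
    using inverse_sqrt_mult_le[OF v] q by (intro mult_left_mono) auto
  also have "\<dots> = (corr s r + corr r s) / 2"
    unfolding corr by (simp add: add_divide_distrib distrib_left)
  finally have "1 / (2 * pi) * (1 / sqrt ((\<epsilon> + var s) * (\<epsilon> + var r) - d)) \<le>
      1 / (2 * pi) * (1 / sqrt ((\<epsilon> + var s) * (\<epsilon> + var r)) + (corr s r + corr r s) / 2)"
    by (intro mult_left_mono) auto
  also have "\<dots> = heat_kernel (\<epsilon> + var s) 0 * heat_kernel (\<epsilon> + var r) 0 + (corr s r + corr r s) / (4 * pi)"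
    using sqrt_two_pi_mult[of "\<epsilon> + var s" "\<epsilon> + var r"]
    unfolding heat_kernel_0 by (simp add: distrib_left add_divide_distrib)
  finally show ?thesis
    using nn_integral_heat_kernel_X_X[OF assms] by (auto simp: d_def intro!: ennreal_leI)
qed

lemma nn_integral_heat_kernel_X_X_le:
  assumes "0 < s" "0 < r" "s \<noteq> r" "0 < \<epsilon>"
  shows "(\<integral>\<^sup>+\<omega>. ennreal (heat_kernel \<epsilon> (X s \<omega>) * heat_kernel \<epsilon> (X r \<omega>)) \<partial>M) \<le>
    ennreal (heat_kernel (\<epsilon> + var s) 0 * heat_kernel (\<epsilon> + var r) 0 + (corr s r + corr r s) / (4 * pi))"
  using nn_integral_heat_kernel_X_X_le_less[of s r \<epsilon>] nn_integral_heat_kernel_X_X_le_less[of r s \<epsilon>] assms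
  by (cases "s < r") (auto simp: ac_simps)

end

section \<open>Moments of the approximate local time\<close>

text \<open>Rounding time down to a grid of mesh \<open>1 / real (Suc n)\<close> leaves countably
  many random variables to choose from, hence a jointly measurable process; path continuity gives
  pointwise convergence as the grid is refined.\<close>

lemma jointly_measurable_of_continuous_paths:
  fixes X :: "real \<Rightarrow> 'a \<Rightarrow> real"
  assumes X: "\<And>t. X t \<in> borel_measurable M" and cont: "\<And>\<omega>. continuous_on UNIV (\<lambda>t. X t \<omega>)"
  shows "(\<lambda>(t, \<omega>). X t \<omega>) \<in> borel_measurable (borel \<Otimes>\<^sub>M M)"
proof (rule borel_measurable_LIMSEQ_real)
  fix n
  have "(\<lambda>z. X (real_of_int i / real (Suc n)) (snd z)) \<in> borel_measurable (borel \<Otimes>\<^sub>M M)" for i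
    by (rule measurable_compose[OF measurable_snd X])
  moreover have "(\<lambda>z. \<lfloor>fst z * real (Suc n)\<rfloor>) \<in> borel \<Otimes>\<^sub>M M \<rightarrow>\<^sub>M count_space UNIV"
    by measurable
  ultimately show "(\<lambda>z. X (real_of_int \<lfloor>fst z * real (Suc n)\<rfloor> / real (Suc n)) (snd z)) \<in> borel_measurable (borel \<Otimes>\<^sub>M M)"
    by (rule measurable_compose_countable)
next
  fix z :: "real \<times> 'a"
  let ?a = "\<lambda>n. real_of_int \<lfloor>fst z * real (Suc n)\<rfloor> / real (Suc n)"
  have "?a \<longlonglongrightarrow> fst z"
  proof (rule tendsto_sandwich)
    show "\<forall>\<^sub>F n in sequentially. fst z - 1 / real (Suc n) \<le> ?a n"
    proof (intro always_eventually allI)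
      fix n
      have "(fst z * real (Suc n) - 1) / real (Suc n) \<le> ?a n"
        by (intro divide_right_mono) linarith+
      then show "fst z - 1 / real (Suc n) \<le> ?a n" by (simp add: diff_divide_distrib)
    qed
    show "\<forall>\<^sub>F n in sequentially. ?a n \<le> fst z"
    proof (intro always_eventually allI)
      fix n
      have "?a n \<le> (fst z * real (Suc n)) / real (Suc n)"
        by (intro divide_right_mono) linarith+
      then show "?a n \<le> fst z" by simp
    qed
    show "(\<lambda>n. fst z - 1 / real (Suc n)) \<longlonglongrightarrow> fst z"
      using tendsto_diff[OF tendsto_const LIMSEQ_Suc[OF lim_1_over_n]] by simp
  qed simp
  then have "(\<lambda>n. X (?a n) (snd z)) \<longlonglongrightarrow> X (fst z) (snd z)"
    using cont[of "snd z"] by (auto simp: continuous_on_eq_continuous_at intro: isCont_tendsto_compose)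
  then show "(\<lambda>n. X (?a n) (snd z)) \<longlonglongrightarrow> (case z of (t, \<omega>) \<Rightarrow> X t \<omega>)"
    by (simp add: case_prod_unfold)
qed

context ou_process
begin

text \<open>Nothing is known about the process at negative times, so it is frozen there at its
  initial value.\<close>

lemma X_joint [measurable]: "(\<lambda>(t, \<omega>). X (max 0 t) \<omega>) \<in> borel_measurable (borel \<Otimes>\<^sub>M M)"
proof (rule jointly_measurable_of_continuous_paths)
  show "continuous_on UNIV (\<lambda>t. X (max 0 t) \<omega>)" for \<omega>
    by (rule continuous_on_compose2[OF X_cont]) (auto intro: continuous_intros)
qed (simp add: X_measurable)

lemma approx_local_time_nonneg: "0 \<le> \<epsilon> \<Longrightarrow> 0 \<le> approx_local_time X 0 \<epsilon> t \<omega>"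
  unfolding approx_local_time_def set_lebesgue_integral_def
  by (intro Bochner_Integration.integral_nonneg) (auto simp: heat_kernel_nonneg split: split_indicator)

text \<open>Path continuity makes the integrand integrable on the compact interval, so the Bochner
  integral does not fall back to its default 0. In the nonnegative form Tonelli applies without
  integrability conditions.\<close>

lemma ennreal_approx_local_time:
  assumes "0 < \<epsilon>"
  shows "ennreal (approx_local_time X 0 \<epsilon> t \<omega>) =
    (\<integral>\<^sup>+r\<in>{0..t}. ennreal (heat_kernel \<epsilon> (X (max 0 r) \<omega>)) \<partial>lborel)"
proof -
  have "continuous_on {0..t} (\<lambda>r. heat_kernel \<epsilon> (X r \<omega>))"
    by (rule continuous_on_compose2[of UNIV "heat_kernel \<epsilon>"])
      (auto simp: continuous_on_eq_continuous_at isCont_heat_kernel intro: continuous_on_subset[OF X_cont])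
  then have "integrable lborel (\<lambda>r. indicator {0..t} r *\<^sub>R heat_kernel \<epsilon> (X r \<omega>))"
    using borel_integrable_atLeastAtMost' unfolding set_integrable_def by blast
  then have "ennreal (approx_local_time X 0 \<epsilon> t \<omega>) =
      (\<integral>\<^sup>+r. ennreal (indicator {0..t} r *\<^sub>R heat_kernel \<epsilon> (X r \<omega>)) \<partial>lborel)"
    unfolding approx_local_time_def set_lebesgue_integral_def using assms
    by (subst nn_integral_eq_integral) (auto simp: heat_kernel_nonneg split: split_indicator)
  also have "\<dots> = (\<integral>\<^sup>+r\<in>{0..t}. ennreal (heat_kernel \<epsilon> (X (max 0 r) \<omega>)) \<partial>lborel)"
    by (intro nn_integral_cong) (auto simp: max_def split: split_indicator)
  finally show ?thesis .
qed

lemma approx_local_time_measurable [measurable]: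
  assumes "0 < \<epsilon>"
  shows "approx_local_time X 0 \<epsilon> t \<in> borel_measurable M"
proof -
  have "approx_local_time X 0 \<epsilon> t =
      (\<lambda>\<omega>. enn2real (\<integral>\<^sup>+r\<in>{0..t}. ennreal (heat_kernel \<epsilon> (X (max 0 r) \<omega>)) \<partial>lborel))"
    using assms by (simp add: ennreal_approx_local_time[symmetric] approx_local_time_nonneg)
  also have "\<dots> \<in> borel_measurable M" by measurable
  finally show ?thesis .
qed

lemma nn_integral_approx_local_time:
  assumes "0 < \<epsilon>"
  shows "(\<integral>\<^sup>+\<omega>. ennreal (approx_local_time X 0 \<epsilon> t \<omega>) \<partial>M) =
    (\<integral>\<^sup>+r\<in>{0..t}. ennreal (heat_kernel (\<epsilon> + var r) 0) \<partial>lborel)"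
proof -
  interpret P: pair_sigma_finite lborel M ..
  have "(\<integral>\<^sup>+\<omega>. ennreal (approx_local_time X 0 \<epsilon> t \<omega>) \<partial>M) =
      (\<integral>\<^sup>+\<omega>. \<integral>\<^sup>+r. ennreal (heat_kernel \<epsilon> (X (max 0 r) \<omega>)) * indicator {0..t} r \<partial>lborel \<partial>M)"
    using assms by (simp add: ennreal_approx_local_time)
  also have "\<dots> = (\<integral>\<^sup>+r. \<integral>\<^sup>+\<omega>. ennreal (heat_kernel \<epsilon> (X (max 0 r) \<omega>)) * indicator {0..t} r \<partial>M \<partial>lborel)"
    by (rule P.Fubini') measurable
  also have "\<dots> = (\<integral>\<^sup>+r\<in>{0..t}. ennreal (heat_kernel (\<epsilon> + var r) 0) \<partial>lborel)"
  proof (rule nn_integral_cong_AE)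
    show "AE r in lborel. (\<integral>\<^sup>+\<omega>. ennreal (heat_kernel \<epsilon> (X (max 0 r) \<omega>)) * indicator {0..t} r \<partial>M) =
        ennreal (heat_kernel (\<epsilon> + var r) 0) * indicator {0..t} r"
      using AE_lborel_singleton[of 0]
      by eventually_elim
        (use assms nn_integral_heat_kernel_X in \<open>auto simp: max_def split: split_indicator\<close>)
  qed
  finally show ?thesis .
qed

text \<open>The square is a double time integral. The product part of the two-point bound integrates
  to the squared mean, and each of the two correlation terms contributes at most
  \<open>t / pi\<close>: the inner integral is at most 4 / (4 pi), and the outer variable ranges
  over length \<open>t\<close>.\<close>

lemma nn_integral_approx_local_time_square_le:
  assumes "0 < \<epsilon>" "0 \<le> t"
  shows "(\<integral>\<^sup>+\<omega>. (ennreal (approx_local_time X 0 \<epsilon> t \<omega>))\<^sup>2 \<partial>M) \<le>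
    (\<integral>\<^sup>+\<omega>. ennreal (approx_local_time X 0 \<epsilon> t \<omega>) \<partial>M)\<^sup>2 + ennreal (2 * t / pi)"
proof -
  interpret P: pair_sigma_finite lborel M ..
  define g where "g r \<omega> = ennreal (heat_kernel \<epsilon> (X (max 0 r) \<omega>)) * indicator {0..t} r" for r \<omega>
  define m where "m r = ennreal (heat_kernel (\<epsilon> + var r) 0) * indicator {0..t} r" for r
  \<comment> \<open>The first variable is kept strictly inside the interval, as
    \<open>nn_integral_corr_le\<close> requires; the endpoints that are lost form a null
    set.\<close>
  define k where "k s r = ennreal (corr s r / (4 * pi)) * indicator {0<..<t} s * indicator {0..t} r" for s r
  have [measurable]: "case_prod g \<in> borel_measurable (borel \<Otimes>\<^sub>M M)" unfolding g_def by measurable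
  have [measurable]: "m \<in> borel_measurable borel" unfolding m_def heat_kernel_0 by measurable
  have [measurable]: "case_prod k \<in> borel_measurable (borel \<Otimes>\<^sub>M borel)" unfolding k_def by measurable
  have k_int: "(\<integral>\<^sup>+s. \<integral>\<^sup>+r. k s r \<partial>lborel \<partial>lborel) \<le> ennreal (t / pi)"
  proof -
    have "(\<integral>\<^sup>+r. k s r \<partial>lborel) \<le> ennreal (1 / pi) * indicator {0..t} s" for s
    proof (cases "s \<in> {0<..<t}")
      case True
      have "(\<integral>\<^sup>+r. k s r \<partial>lborel) = (\<integral>\<^sup>+r. ennreal (1 / (4 * pi)) * (ennreal (corr s r) * indicator {0..t} r) \<partial>lborel)"
        using True by (intro nn_integral_cong) (auto simp: k_def ennreal_mult'[symmetric] split: split_indicator)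
      also have "\<dots> = ennreal (1 / (4 * pi)) * (\<integral>\<^sup>+r. ennreal (corr s r) * indicator {0..t} r \<partial>lborel)"
        by (intro nn_integral_cmult) measurable
      also have "\<dots> \<le> ennreal (1 / (4 * pi)) * ennreal 4"
        using nn_integral_corr_le[of s t] True by (intro mult_left_mono) auto
      also have "\<dots> = ennreal (1 / pi)" by (subst ennreal_mult[symmetric]) auto
      finally show ?thesis using True by simp
    qed (simp add: k_def)
    then have "(\<integral>\<^sup>+s. \<integral>\<^sup>+r. k s r \<partial>lborel \<partial>lborel) \<le> (\<integral>\<^sup>+s. ennreal (1 / pi) * indicator {0..t} s \<partial>lborel)"
      by (intro nn_integral_mono)
    also have "\<dots> = ennreal (t / pi)"
      using \<open>0 \<le> t\<close> by (simp add: nn_integral_cmult ennreal_mult[symmetric])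
    finally show ?thesis .
  qed
  have gg: "AE r in lborel. (\<integral>\<^sup>+\<omega>. g s \<omega> * g r \<omega> \<partial>M) \<le> m s * m r + (k s r + k r s)" if s: "s \<noteq> 0" "s \<noteq> t" for s
    using AE_lborel_singleton[of 0] AE_lborel_singleton[of t] AE_lborel_singleton[of s]
  proof eventually_elim
    case (elim r)
    show ?case
    proof (cases "s \<in> {0..t} \<and> r \<in> {0..t}")
      case True
      with s elim have sr: "0 < s" "s < t" "0 < r" "r < t" by auto
      have corr_nonneg: "0 \<le> corr a b" if "0 < a" "0 < b" for a b
        using that clock_pos[of a] clock_pos[of b] clock_less[of a b] clock_less[of b a]
        by (cases a b rule: linorder_cases) (auto simp: corr_def Let_def min_def max_def intro!: mult_nonneg_nonneg divide_nonneg_nonneg)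
      have "(\<integral>\<^sup>+\<omega>. g s \<omega> * g r \<omega> \<partial>M) = (\<integral>\<^sup>+\<omega>. ennreal (heat_kernel \<epsilon> (X s \<omega>) * heat_kernel \<epsilon> (X r \<omega>)) \<partial>M)"
        using sr assms by (simp add: g_def ennreal_mult heat_kernel_nonneg)
      also have "\<dots> \<le> ennreal (heat_kernel (\<epsilon> + var s) 0 * heat_kernel (\<epsilon> + var r) 0 + (corr s r + corr r s) / (4 * pi))"
        using sr elim assms by (intro nn_integral_heat_kernel_X_X_le) auto
      also have "\<dots> = m s * m r + (k s r + k r s)"
        using sr assms corr_nonneg[of s r] corr_nonneg[of r s] var_nonneg[of s] var_nonneg[of r]
        by (simp add: m_def k_def ennreal_mult heat_kernel_nonneg add_divide_distrib)
      finally show ?thesis .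
    qed (auto simp: g_def)
  qed
  have "(\<integral>\<^sup>+\<omega>. (ennreal (approx_local_time X 0 \<epsilon> t \<omega>))\<^sup>2 \<partial>M) =
      (\<integral>\<^sup>+\<omega>. (\<integral>\<^sup>+s. \<integral>\<^sup>+r. g s \<omega> * g r \<omega> \<partial>lborel \<partial>lborel) \<partial>M)"
  proof (rule nn_integral_cong)
    fix \<omega> assume [measurable]: "\<omega> \<in> space M"
    have "(ennreal (approx_local_time X 0 \<epsilon> t \<omega>))\<^sup>2 = (\<integral>\<^sup>+s. g s \<omega> \<partial>lborel) * (\<integral>\<^sup>+r. g r \<omega> \<partial>lborel)"
      using assms by (simp add: ennreal_approx_local_time power2_eq_square g_def)
    also have "\<dots> = (\<integral>\<^sup>+s. g s \<omega> * (\<integral>\<^sup>+r. g r \<omega> \<partial>lborel) \<partial>lborel)"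
      by (rule nn_integral_multc[symmetric]) measurable
    also have "\<dots> = (\<integral>\<^sup>+s. \<integral>\<^sup>+r. g s \<omega> * g r \<omega> \<partial>lborel \<partial>lborel)"
      by (intro nn_integral_cong nn_integral_cmult[symmetric]) measurable
    finally show "(ennreal (approx_local_time X 0 \<epsilon> t \<omega>))\<^sup>2 = (\<integral>\<^sup>+s. \<integral>\<^sup>+r. g s \<omega> * g r \<omega> \<partial>lborel \<partial>lborel)" .
  qed
  also have "\<dots> = (\<integral>\<^sup>+s. (\<integral>\<^sup>+\<omega>. \<integral>\<^sup>+r. g s \<omega> * g r \<omega> \<partial>lborel \<partial>M) \<partial>lborel)"
    by (rule P.Fubini') measurable
  also have "\<dots> = (\<integral>\<^sup>+s. \<integral>\<^sup>+r. (\<integral>\<^sup>+\<omega>. g s \<omega> * g r \<omega> \<partial>M) \<partial>lborel \<partial>lborel)"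
    by (intro nn_integral_cong P.Fubini') measurable
  also have "\<dots> \<le> (\<integral>\<^sup>+s. \<integral>\<^sup>+r. m s * m r + (k s r + k r s) \<partial>lborel \<partial>lborel)"
    by (rule nn_integral_mono_AE)
      (use AE_lborel_singleton[of 0] AE_lborel_singleton[of t] in eventually_elim, rule nn_integral_mono_AE, rule gg)
  also have "\<dots> = (\<integral>\<^sup>+s. \<integral>\<^sup>+r. m s * m r \<partial>lborel \<partial>lborel) +
      ((\<integral>\<^sup>+s. \<integral>\<^sup>+r. k s r \<partial>lborel \<partial>lborel) + (\<integral>\<^sup>+s. \<integral>\<^sup>+r. k r s \<partial>lborel \<partial>lborel))"
    by (simp add: nn_integral_add)
  also have "(\<integral>\<^sup>+s. \<integral>\<^sup>+r. m s * m r \<partial>lborel \<partial>lborel) = (\<integral>\<^sup>+s. m s \<partial>lborel)\<^sup>2"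
    by (simp add: nn_integral_cmult nn_integral_multc power2_eq_square)
  also have "(\<integral>\<^sup>+s. \<integral>\<^sup>+r. k r s \<partial>lborel \<partial>lborel) = (\<integral>\<^sup>+s. \<integral>\<^sup>+r. k s r \<partial>lborel \<partial>lborel)"
    by (rule lborel_pair.Fubini') measurable
  also have "(\<integral>\<^sup>+s. m s \<partial>lborel)\<^sup>2 + ((\<integral>\<^sup>+s. \<integral>\<^sup>+r. k s r \<partial>lborel \<partial>lborel) + (\<integral>\<^sup>+s. \<integral>\<^sup>+r. k s r \<partial>lborel \<partial>lborel)) \<le>
      (\<integral>\<^sup>+s. m s \<partial>lborel)\<^sup>2 + (ennreal (t / pi) + ennreal (t / pi))"
    by (intro add_mono k_int order_refl)
  also have "ennreal (t / pi) + ennreal (t / pi) = ennreal (2 * t / pi)"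
    using \<open>0 \<le> t\<close> by (simp add: ennreal_plus[symmetric] del: ennreal_plus)
  also have "(\<integral>\<^sup>+s. m s \<partial>lborel) = (\<integral>\<^sup>+\<omega>. ennreal (approx_local_time X 0 \<epsilon> t \<omega>) \<partial>M)"
    using assms by (simp add: nn_integral_approx_local_time m_def)
  finally show ?thesis .
qed

section \<open>Concentration and almost sure divergence\<close>

text \<open>This is the value at 0 of the heat kernel with parameter \<open>1 + 1 / (2 * c)\<close>,
  the upper bound of \<open>\<epsilon> + var r\<close> for \<epsilon> at most 1. It is thus a lower
  bound for the growth rate of the mean.\<close>

definition rate :: real where
  "rate = 1 / sqrt (2 * pi * (1 + 1 / (2 * c)))"

lemma rate_pos: "0 < rate"
  using c_pos by (simp add: rate_def add_pos_pos)

text \<open>The mean is at least \<open>rate * t\<close> and the variance at most \<open>t\<close>,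
  so falling below \<open>rate * t / 2\<close> is a deviation of at least that size, and Chebyshev
  applies. The bound is the same for all \<epsilon> up to 1, which allows the passage to the
  limit.\<close>

lemma prob_approx_local_time_le:
  assumes "0 < \<epsilon>" "\<epsilon> \<le> 1" "0 < t"
  shows "prob {\<omega> \<in> space M. approx_local_time X 0 \<epsilon> t \<omega> \<le> rate * t / 2} \<le> 4 / (rate\<^sup>2 * t)"
proof -
  let ?L = "approx_local_time X 0 \<epsilon> t"
  have [measurable]: "?L \<in> borel_measurable M" using assms by simp
  have nonneg: "0 \<le> ?L \<omega>" for \<omega> using assms by (simp add: approx_local_time_nonneg)
  have mean: "(\<integral>\<^sup>+\<omega>. ennreal (?L \<omega>) \<partial>M) = (\<integral>\<^sup>+r\<in>{0..t}. ennreal (heat_kernel (\<epsilon> + var r) 0) \<partial>lborel)"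
    using assms by (intro nn_integral_approx_local_time)
  \<comment> \<open>This bound degenerates as \<epsilon> tends to 0, but it only serves to make the
    approximation integrable for fixed \<epsilon>.\<close>
  have fin: "(\<integral>\<^sup>+\<omega>. ennreal (?L \<omega>) \<partial>M) < \<infinity>"
  proof -
    have "(\<integral>\<^sup>+\<omega>. ennreal (?L \<omega>) \<partial>M) \<le> (\<integral>\<^sup>+r. ennreal (heat_kernel \<epsilon> 0) * indicator {0..t} r \<partial>lborel)"
      unfolding mean
    proof (rule nn_integral_mono)
      fix r
      have "heat_kernel (\<epsilon> + var r) 0 \<le> heat_kernel \<epsilon> 0" if "0 \<le> r"
        using var_nonneg[OF that] assms by (auto simp: heat_kernel_0 intro!: divide_left_mono)
      then show "ennreal (heat_kernel (\<epsilon> + var r) 0) * indicator {0..t} r \<le> ennreal (heat_kernel \<epsilon> 0) * indicator {0..t} r"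
        by (auto split: split_indicator intro: ennreal_leI)
    qed
    also have "\<dots> < \<infinity>" using assms by (simp add: nn_integral_cmult ennreal_mult_less_top)
    finally show ?thesis .
  qed
  then have int: "integrable M ?L"
    using nonneg by (intro integrableI_nonneg) auto
  have E: "(\<integral>\<^sup>+\<omega>. ennreal (?L \<omega>) \<partial>M) = ennreal (expectation ?L)"
    using int nonneg by (intro nn_integral_eq_integral) auto
  have E_nonneg: "0 \<le> expectation ?L" using nonneg by (intro Bochner_Integration.integral_nonneg) auto
  have "ennreal (rate * t) = (\<integral>\<^sup>+r. ennreal rate * indicator {0..t} r \<partial>lborel)"
    using assms rate_pos by (simp add: nn_integral_cmult ennreal_mult)
  also have "\<dots> \<le> (\<integral>\<^sup>+r. ennreal (heat_kernel (\<epsilon> + var r) 0) * indicator {0..t} r \<partial>lborel)"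
  proof (rule nn_integral_mono)
    fix r
    have "rate \<le> heat_kernel (\<epsilon> + var r) 0" if "0 \<le> r"
      unfolding rate_def heat_kernel_0 using var_nonneg[OF that] var_le[OF that] assms c_pos
      by (intro divide_left_mono) (auto intro!: mult_pos_pos add_mono add_pos_nonneg)
    then show "ennreal rate * indicator {0..t} r \<le> ennreal (heat_kernel (\<epsilon> + var r) 0) * indicator {0..t} r"
      by (auto split: split_indicator intro: ennreal_leI)
  qed
  finally have E_ge: "rate * t \<le> expectation ?L"
    unfolding mean[symmetric] E using E_nonneg by simp
  have sq: "(\<integral>\<^sup>+\<omega>. ennreal ((?L \<omega>)\<^sup>2) \<partial>M) \<le> ennreal ((expectation ?L)\<^sup>2 + 2 * t / pi)"
    using nn_integral_approx_local_time_square_le[of \<epsilon> t] assms nonneg E_nonneg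
    by (simp add: E ennreal_power)
  then have int2: "integrable M (\<lambda>\<omega>. (?L \<omega>)\<^sup>2)"
    by (intro integrableI_nonneg) (auto intro: order.strict_trans1 ennreal_less_top)
  then have "expectation (\<lambda>\<omega>. (?L \<omega>)\<^sup>2) \<le> (expectation ?L)\<^sup>2 + 2 * t / pi"
    using sq assms by (subst (asm) nn_integral_eq_integral) (auto simp del: ennreal_plus)
  then have "variance ?L \<le> 2 * t / pi"
    using int int2 by (simp add: variance_eq)
  also have "\<dots> \<le> t" using pi_ge_two assms by (simp add: field_simps)
  finally have var: "variance ?L \<le> t" .
  have "prob {\<omega> \<in> space M. ?L \<omega> \<le> rate * t / 2} \<le> prob {\<omega> \<in> space M. rate * t / 2 \<le> \<bar>?L \<omega> - expectation ?L\<bar>}"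
  proof (rule finite_measure_mono)
    have "rate * t / 2 \<le> \<bar>?L \<omega> - expectation ?L\<bar>" if "?L \<omega> \<le> rate * t / 2" for \<omega>
      using that E_ge by linarith
    then show "{\<omega> \<in> space M. ?L \<omega> \<le> rate * t / 2} \<subseteq> {\<omega> \<in> space M. rate * t / 2 \<le> \<bar>?L \<omega> - expectation ?L\<bar>}"
      by blast
  qed measurable
  also have "\<dots> \<le> variance ?L / (rate * t / 2)\<^sup>2"
    using int2 assms rate_pos by (intro Chebyshev_inequality) auto
  also have "\<dots> \<le> t / (rate * t / 2)\<^sup>2"
    using var by (intro divide_right_mono) auto
  also have "\<dots> = 4 / (rate\<^sup>2 * t)"
    using assms rate_pos by (simp add: power2_eq_square field_simps)
  finally show ?thesis .
qed

text \<open>If \<open>L\<close> is below the lowered threshold, then either the approximation is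
  below \<open>rate * t / 2\<close> or the two differ by more than 1. The first event is controlled
  by Chebyshev; by Markov, the second has probability at most the squared distance in mean, which
  vanishes with \<epsilon>.\<close>

lemma emeasure_local_time_le:
  assumes L [measurable]: "L \<in> borel_measurable M"
    and lim: "((\<lambda>\<epsilon>. \<integral>\<^sup>+\<omega>. ennreal ((approx_local_time X 0 \<epsilon> t \<omega> - L \<omega>)\<^sup>2) \<partial>M) \<longlongrightarrow> 0) (at_right 0)"
    and "0 < t"
  shows "emeasure M {\<omega> \<in> space M. L \<omega> \<le> rate * t / 2 - 1} \<le> ennreal (4 / (rate\<^sup>2 * t))"
proof -
  let ?I = "\<lambda>\<epsilon>. \<integral>\<^sup>+\<omega>. ennreal ((approx_local_time X 0 \<epsilon> t \<omega> - L \<omega>)\<^sup>2) \<partial>M"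
  have "emeasure M {\<omega> \<in> space M. L \<omega> \<le> rate * t / 2 - 1} \<le> ennreal (4 / (rate\<^sup>2 * t)) + ?I \<epsilon>"
    if \<epsilon>: "0 < \<epsilon>" "\<epsilon> < 1" for \<epsilon>
  proof -
    let ?A = "approx_local_time X 0 \<epsilon> t"
    have [measurable]: "?A \<in> borel_measurable M" using \<epsilon> by simp
    have "emeasure M {\<omega> \<in> space M. L \<omega> \<le> rate * t / 2 - 1} \<le>
        emeasure M ({\<omega> \<in> space M. ?A \<omega> \<le> rate * t / 2} \<union> {\<omega> \<in> space M. 1 \<le> 1 * ennreal ((?A \<omega> - L \<omega>)\<^sup>2)})"
    proof (rule emeasure_mono)
      have "1 \<le> 1 * ennreal ((?A \<omega> - L \<omega>)\<^sup>2)" if "L \<omega> \<le> rate * t / 2 - 1" "\<not> ?A \<omega> \<le> rate * t / 2" for \<omega>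
        using that by (simp add: one_le_power)
      then show "{\<omega> \<in> space M. L \<omega> \<le> rate * t / 2 - 1} \<subseteq>
          {\<omega> \<in> space M. ?A \<omega> \<le> rate * t / 2} \<union> {\<omega> \<in> space M. 1 \<le> 1 * ennreal ((?A \<omega> - L \<omega>)\<^sup>2)}"
        by blast
    qed measurable
    also have "\<dots> \<le> emeasure M {\<omega> \<in> space M. ?A \<omega> \<le> rate * t / 2} +
        emeasure M {\<omega> \<in> space M. 1 \<le> 1 * ennreal ((?A \<omega> - L \<omega>)\<^sup>2)}"
      by (rule emeasure_subadditive) measurable
    also have "\<dots> \<le> ennreal (4 / (rate\<^sup>2 * t)) + ?I \<epsilon>"
    proof (rule add_mono)
      show "emeasure M {\<omega> \<in> space M. ?A \<omega> \<le> rate * t / 2} \<le> ennreal (4 / (rate\<^sup>2 * t))"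
        using prob_approx_local_time_le[of \<epsilon> t] \<epsilon> \<open>0 < t\<close> by (simp add: emeasure_eq_measure ennreal_leI)
      have "emeasure M {\<omega> \<in> space M. 1 \<le> 1 * ennreal ((?A \<omega> - L \<omega>)\<^sup>2)} \<le>
          1 * (\<integral>\<^sup>+\<omega>. ennreal ((?A \<omega> - L \<omega>)\<^sup>2) * indicator (space M) \<omega> \<partial>M)"
        by (rule nn_integral_Markov_inequality) measurable
      also have "\<dots> = ?I \<epsilon>"
        unfolding mult_1 by (rule nn_integral_cong) simp
      finally show "emeasure M {\<omega> \<in> space M. 1 \<le> 1 * ennreal ((?A \<omega> - L \<omega>)\<^sup>2)} \<le> ?I \<epsilon>" .
    qed
    finally show ?thesis .
  qed
  then have "\<forall>\<^sub>F \<epsilon> in at_right 0. emeasure M {\<omega> \<in> space M. L \<omega> \<le> rate * t / 2 - 1} \<le> ennreal (4 / (rate\<^sup>2 * t)) + ?I \<epsilon>"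
    by (intro eventually_at_rightI[of 0 1]) auto
  moreover have "((\<lambda>\<epsilon>. ennreal (4 / (rate\<^sup>2 * t)) + ?I \<epsilon>) \<longlongrightarrow> ennreal (4 / (rate\<^sup>2 * t)) + 0) (at_right 0)"
    by (intro tendsto_add tendsto_const lim)
  ultimately show ?thesis
    by (intro tendsto_lowerbound[of _ "ennreal (4 / (rate\<^sup>2 * t))"]) auto
qed

text \<open>The event that all values at integer times stay below a fixed \<open>K\<close> is
  contained in events of arbitrarily small probability, hence is null. Countably many
  \<open>K\<close> give unboundedness along the integers, and monotone paths turn this into
  divergence.\<close>

lemma AE_local_time_at_top:
  assumes "local_time M X 0 L"
  shows "AE \<omega> in M. filterlim (\<lambda>t. L t \<omega>) at_top at_top"
proof -
  have L [measurable]: "L (real n) \<in> borel_measurable M" for n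
    using assms by (auto simp: local_time_def)
  have "AE \<omega> in M. \<not> (\<forall>n. L (real n) \<omega> \<le> real K)" for K :: nat
  proof (rule AE_I)
    let ?N = "{\<omega> \<in> space M. \<forall>n. L (real n) \<omega> \<le> real K}"
    show "?N \<in> sets M" by measurable
    have "(\<lambda>n. ennreal (4 / (rate\<^sup>2 * real n))) \<longlonglongrightarrow> ennreal 0"
    proof (rule tendsto_ennrealI)
      have "(\<lambda>n. 4 / rate\<^sup>2 * (1 / real n)) \<longlonglongrightarrow> 4 / rate\<^sup>2 * 0"
        by (intro tendsto_mult tendsto_const lim_1_over_n)
      then show "(\<lambda>n. 4 / (rate\<^sup>2 * real n)) \<longlonglongrightarrow> 0" by simp
    qed
    moreover have "\<forall>\<^sub>F n in sequentially. emeasure M ?N \<le> ennreal (4 / (rate\<^sup>2 * real n))"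
    proof -
      \<comment> \<open>From \<open>n0\<close> on, the threshold
        \<open>rate * real n / 2 - 1\<close> lies above \<open>K\<close>.\<close>
      obtain n0 where n0: "(real K + 1) * 2 / rate < real n0" using reals_Archimedean2 by blast
      show ?thesis
        using eventually_ge_at_top[of n0] eventually_gt_at_top[of 0]
      proof eventually_elim
        case (elim n)
        have "(real K + 1) * 2 / rate < real n" using n0 elim by linarith
        then have "real K \<le> rate * real n / 2 - 1"
          using rate_pos by (simp add: field_simps)
        then have "emeasure M ?N \<le> emeasure M {\<omega> \<in> space M. L (real n) \<omega> \<le> rate * real n / 2 - 1}"
          by (intro emeasure_mono) (auto intro: order_trans)
        also have "\<dots> \<le> ennreal (4 / (rate\<^sup>2 * real n))"
          using assms elim by (intro emeasure_local_time_le) (auto simp: local_time_def)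
        finally show ?case .
      qed
    qed
    ultimately have "emeasure M ?N \<le> ennreal 0"
      by (rule tendsto_lowerbound) simp
    then show "emeasure M ?N = 0" by simp
  qed simp
  then have "AE \<omega> in M. \<forall>K::nat. \<not> (\<forall>n. L (real n) \<omega> \<le> real K)"
    by (simp add: AE_all_countable)
  moreover have "AE \<omega> in M. mono_on {0..} (\<lambda>t. L t \<omega>)"
    using assms by (simp add: local_time_def)
  ultimately show ?thesis
  proof eventually_elim
    case (elim \<omega>)
    show ?case
      unfolding filterlim_at_top
    proof
      fix Z :: real
      obtain K :: nat where K: "Z \<le> real K" using real_arch_simple by blast
      obtain n where n: "real K < L (real n) \<omega>" using elim(1) by (auto simp: not_le)
      show "\<forall>\<^sub>F t in at_top. Z \<le> L t \<omega>"
        using eventually_ge_at_top[of "real n"]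
      proof eventually_elim
        case (elim t)
        then have "L (real n) \<omega> \<le> L t \<omega>"
          using \<open>mono_on {0..} (\<lambda>t. L t \<omega>)\<close> by (auto intro: mono_onD)
        with K n show ?case by linarith
      qed
    qed
  qed
qed

end

section \<open>A uniform lower bound for the drift, and the theorem\<close>

lemma continuous_positive_imp_bounded_below:
  fixes f :: "real \<Rightarrow> real"
  assumes cont: "continuous_on {0..} f" and pos: "\<And>t. 0 \<le> t \<Longrightarrow> 0 < f t"
    and far: "0 < d" "0 \<le> T" "\<And>t. T \<le> t \<Longrightarrow> d \<le> f t"
  obtains c where "0 < c" "\<And>t. 0 \<le> t \<Longrightarrow> c \<le> f t"
proof -
  have "\<exists>x\<in>{0..T}. \<forall>y\<in>{0..T}. f x \<le> f y"
    using far by (intro continuous_attains_inf continuous_on_subset[OF cont]) auto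
  then obtain x where x: "x \<in> {0..T}" "\<And>y. y \<in> {0..T} \<Longrightarrow> f x \<le> f y" by blast
  show ?thesis
  proof (rule that[of "min (f x) d"])
    show "min (f x) d \<le> f t" if "0 \<le> t" for t
      using x(2)[of t] far(3)[of t] that by (cases "t \<le> T") auto
  qed (use pos[of x] x(1) far in auto)
qed

theorem theorem3p2:
  fixes M :: "'a measure" and F :: "real \<Rightarrow> 'a measure"
    and W X L :: "real \<Rightarrow> 'a \<Rightarrow> real" and \<alpha> \<alpha>' :: "real \<Rightarrow> real"
  assumes "complete_filtered_prob_space M F"
    and "brownian_motion M F W"
    and "\<And>t. 0 \<le> t \<Longrightarrow> 0 < \<alpha> t"
    and "\<And>t. 0 \<le> t \<Longrightarrow> (\<alpha> has_real_derivative \<alpha>' t) (at t within {0..})"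
    and "continuous_on {0..} \<alpha>'"
    (* at t = 0 the bound is vacuous by the convention that 0 to a negative power is infinite *)
    and "\<exists>\<gamma> \<beta> C. 0 \<le> \<gamma> \<and> \<gamma> \<le> 1 / 2 \<and> 0 < \<beta> \<and> 0 < C \<and>
           (\<forall>t>0. running_sup \<alpha> (t + 1) powr (2 * \<gamma>) / \<alpha> t \<le> C * t powr (- \<beta>))"
    and "bdd_above ((\<lambda>t. \<bar>\<alpha>' t / \<alpha> t\<bar>) ` {0..})"
    and "\<exists>\<rho> t0 C. 1 < \<rho> \<and> 0 < t0 \<and> 0 < C \<and> (\<forall>t\<ge>t0. C * t powr \<rho> \<le> \<alpha> t)"
    and "sde_solution M F W \<alpha> X"
    and "local_time M X 0 L"
  shows "AE \<omega> in M. filterlim (\<lambda>t. L t \<omega>) at_top at_top"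
proof -
  interpret complete_filtered_prob_space M F by fact
  have cont_\<alpha>: "continuous_on {0..} \<alpha>"
    using assms(4) by (auto simp: continuous_on_eq_continuous_within intro!: DERIV_continuous)
  obtain \<rho> t0 C where \<rho>: "1 < \<rho>" "0 < t0" "0 < C" "\<And>t. t0 \<le> t \<Longrightarrow> C * t powr \<rho> \<le> \<alpha> t"
    using assms(8) by blast
  \<comment> \<open>Powers with positive exponent increase, so the growth condition bounds the drift
    from below by its value at \<open>t0\<close> at all later times.\<close>
  have far: "C * t0 powr \<rho> \<le> \<alpha> t" if "t0 \<le> t" for t
  proof -
    have "C * t0 powr \<rho> \<le> C * t powr \<rho>"
      using \<rho> that by (intro mult_left_mono powr_mono2) auto
    with \<rho>(4)[OF that] show ?thesis by linarith
  qed
  obtain c where c: "0 < c" "\<And>t. 0 \<le> t \<Longrightarrow> c \<le> \<alpha> t"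
  proof (rule continuous_positive_imp_bounded_below[where f = \<alpha> and d = "C * t0 powr \<rho>" and T = t0])
  qed (use cont_\<alpha> assms(3) \<rho> far that in auto)
  \<comment> \<open>Replacing the solution by 0 on the exceptional set makes every path continuous.
    The equation holds almost surely as before, and the approximate local times change only on a
    null set, so \<open>L\<close> remains a local time of the modified process.\<close>
  define G where "G = {\<omega> \<in> space M. continuous_on {0..} (\<lambda>t. X t \<omega>)}"
  define X' where "X' t \<omega> = (if \<omega> \<in> G then X t \<omega> else 0)" for t \<omega>
  have AE_G: "AE \<omega> in M. \<omega> \<in> G"
    using assms(9) AE_space unfolding sde_solution_def continuous_paths_def
    by (auto simp: G_def)
  \<comment> \<open>Completeness makes the exceptional set a measurable null set, and the filtration
    contains the null sets from time 0 on, so the modification stays adapted.\<close>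
  have G_F: "G \<in> sets (F t)" if "0 \<le> t" for t
  proof -
    have "space M - G \<in> null_sets M"
      using AE_G unfolding AE_iff_null_sets by (simp add: set_diff_eq)
    then have "space M - G \<in> sets (F t)"
      using null_sets_F F_mono[of 0 t] that by auto
    moreover have "G = space (F t) - (space M - G)"
      using subalgebra_F[OF that] by (auto simp: G_def subalgebra_def)
    ultimately show ?thesis by (metis sets.compl_sets)
  qed
  have X_eq: "AE \<omega> in M. \<forall>t\<ge>0. X t \<omega> = (LINT s:{0..t}|lborel. - \<alpha> s * X s \<omega>) + W t \<omega>"
    and X_0: "AE \<omega> in M. X 0 \<omega> = 0" and X_F: "\<And>t. 0 \<le> t \<Longrightarrow> X t \<in> borel_measurable (F t)"
    using assms(9) by (auto simp: sde_solution_def adapted_def)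
  have X'_cont: "continuous_on {0..} (\<lambda>t. X' t \<omega>)" for \<omega>
    by (cases "\<omega> \<in> G") (simp_all add: X'_def, simp add: G_def)
  interpret X': ou_process M F W \<alpha> c X'
  proof
    show "brownian_motion M F W" "continuous_on {0..} \<alpha>" "0 < c" "\<And>t. 0 \<le> t \<Longrightarrow> c \<le> \<alpha> t"
      by fact+
    show "X' t \<in> borel_measurable (F t)" if "0 \<le> t" for t
      unfolding X'_def[abs_def] using X_F[OF that] G_F[OF that] by measurable
    show "continuous_on {0..} (\<lambda>t. X' t \<omega>)" for \<omega> by fact
    show "AE \<omega> in M. X' 0 \<omega> = 0"
      using X_0 AE_G by eventually_elim (simp add: X'_def)
    show "AE \<omega> in M. \<forall>t\<ge>0. X' t \<omega> = integral {0..t} (\<lambda>u. - \<alpha> u * X' u \<omega>) + W t \<omega>"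
      using X_eq AE_G
    proof eventually_elim
      case (elim \<omega>)
      \<comment> \<open>The integrand is continuous on a compact interval, so the Lebesgue integral
        of the equation agrees with the gauge integral used for the primitives.\<close>
      have "(LINT s:{0..t}|lborel. - \<alpha> s * X' s \<omega>) = integral {0..t} (\<lambda>u. - \<alpha> u * X' u \<omega>)" for t
        by (intro set_borel_integral_eq_integral borel_integrable_atLeastAtMost' continuous_intros
            continuous_on_subset[OF cont_\<alpha>] continuous_on_subset[OF X'_cont]) auto
      with elim show ?case by (simp add: X'_def)
    qed
  qed
  have "(\<integral>\<^sup>+\<omega>. ennreal ((approx_local_time X 0 \<epsilon> t \<omega> - L t \<omega>)\<^sup>2) \<partial>M) =
      (\<integral>\<^sup>+\<omega>. ennreal ((approx_local_time X' 0 \<epsilon> t \<omega> - L t \<omega>)\<^sup>2) \<partial>M)" for \<epsilon> t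
    by (rule nn_integral_cong_AE)
      (use AE_G in eventually_elim, simp add: approx_local_time_def X'_def)
  then have "local_time M X' 0 L"
    using assms(10) by (simp add: local_time_def)
  then show ?thesis by (rule X'.AE_local_time_at_top)
qed

end
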